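(* Fix $\sigma>7/2$ and $\mu_{\min}>0$. There exist constants $M^{(\mathrm e)}>0$ and $M^{(\mathrm o)}>0$, depending on $\mu$ only through $\mu_{\min}$ (so that the bounds are uniform for large $|\mu|$), such that for all $\mu\in\mathbb{R}$ with $|\mu|\ge\mu_{\min}$, all $t=\kappa r$ with $r\ge 0$ and $\kappa\in\{1,-1\}$, and all $f\in L^2(\mathbb{R})$ with $\langle\cdot\rangle^\sigma f\in L^2(\mathbb{R})$, $$\left\|\langle\cdot\rangle^{-\sigma}\lim_{\delta\downarrow0}\left((\mathcal{B}-2\mu-2i\kappa\delta)^{-1}e^{-it\mathcal{B}}\mathcal{P}_{\mathrm c}^{(\mathrm e)}f\right)(\cdot)\right\|_2\le M^{(\mathrm e)}\langle r\rangle^{-1/2}\,\|\langle\cdot\rangle^\sigma f(\cdot)\|_2$$ and $$\left\|\langle\cdot\rangle^{-\sigma}\lim_{\delta\downarrow0}\left((\mathcal{B}-2\mu-2i\kappa\delta)^{-1}e^{-it\mathcal{B}}\mathcal{P}_{\mathrm c}^{(\mathrm o)}f\right)(\cdot)\right\|_2\le M^{(\mathrm o)}\langle r\rangle^{-3/2}\,\|\langle\cdot\rangle^\sigma f(\cdot)\|_2 .$$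
   Context: Notation: $\langle x\rangle=(1+x^2)^{1/2}$, $\langle f,g\rangle=\int_{\mathbb{R}}\overline{f(x)}g(x)\,dx$, and $\|\cdot\|_2$ is the $L^2(\mathbb{R})$ norm; the limit $\delta\downarrow0$ is taken pointwise in $x$. Fix real parameters $0<\rho_1<\rho_2$ and $\theta_1,\theta_2\in\mathbb{R}$, and put $\lambda_k=i\rho_k$, $g_k=e^{i\theta_k}$ for $k=1,2$. For each $x\in\mathbb{R}$ let $a_0(x),a_1(x),b_0(x),b_1(x)\in\mathbb{C}$ be the unique solution of the linear system (for $k=1,2$) $$(\lambda_k^2+a_1\lambda_k+a_0)e^{-2i\lambda_kx}=\overline{g_k}\,(b_1\lambda_k+b_0),\qquad b_1\overline{\lambda_k}+b_0=-g_k(\overline{\lambda_k}^2+a_1\overline{\lambda_k}+a_0)e^{-2i\overline{\lambda_k}x}.$$ Set $a(x,\lambda)=(\lambda^2+a_1(x)\lambda+a_0(x))e^{-2i\lambda x}$ for $\lambda\in\mathbb{C}$, and for $\lambda\ge 0$ $$\Psi_{\mathrm d}^{(\mathrm e)}(x,\lambda)=\frac{a(x,\lambda)+a(x,-\lambda)}{\sqrt{2\pi(\lambda^2+\rho_1^2)(\lambda^2+\rho_2^2)}},\qquad \Psi_{\mathrm d}^{(\mathrm o)}(x,\lambda)=\frac{a(x,\lambda)-a(x,-\lambda)}{\sqrt{2\pi(\lambda^2+\rho_1^2)(\lambda^2+\rho_2^2)}} .$$ These are respectively even and odd in $x$. They are generalized eigenfunctions, at time $0$, of the periodic separable two-soliton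 potential with period $L=\pi/(\rho_2^2-\rho_1^2)$. Let $\Pi$ be the orthogonal projection of $L^2(\mathbb{R})$ onto $\mathrm{span}\{a(\cdot,-i\rho_1),a(\cdot,-i\rho_2)\}$ (the bound states). Define $$(\mathcal{P}_{\mathrm c}^{(\mathrm e)}f)(x)=\int_0^\infty\langle\Psi_{\mathrm d}^{(\mathrm e)}(\cdot,\lambda),f\rangle\Psi_{\mathrm d}^{(\mathrm e)}(x,\lambda)\,d\lambda,\qquad (\mathcal{P}_{\mathrm c}^{(\mathrm o)}f)(x)=\int_0^\infty\langle\Psi_{\mathrm d}^{(\mathrm o)}(\cdot,\lambda),f\rangle\Psi_{\mathrm d}^{(\mathrm o)}(x,\lambda)\,d\lambda$$ (integrals in the usual $L^2$ sense of generalized eigenfunction expansions; $\Pi$, $\mathcal{P}_{\mathrm c}^{(\mathrm e)}$, $\mathcal{P}_{\mathrm c}^{(\mathrm o)}$ are mutually orthogonal projections summing to the identity). The self-adjoint operator $\mathcal{B}$ on $L^2(\mathbb{R})$ is $$\mathcal{B}f=-2\beta_{\mathrm b}\,\Pi f+\sum_{\alpha\in\{\mathrm e,\mathrm o\}}\int_0^\infty 2\lambda^2\langle\Psi_{\mathrm d}^{(\alpha)}(\cdot,\lambda),f\rangle\Psi_{\mathrm d}^{(\alpha)}(x,\lambda)\,d\lambda,$$ where $\beta_{\mathrm b}>0$ is a fixed number with $e^{2i\beta_{\mathrm b}L}=e^{2i\rho_1^2L}=e^{2i\rho_2^2L}$. Thus, for $\delta>0$, $$(\mathcal{B}-2\mu-2i\kappa\delta)^{-1}e^{-it\mathcal{B}}\mathcal{P}_{\mathrm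 c}^{(\alpha)}f=\int_0^\infty\frac{e^{-2i\lambda^2t}}{2\lambda^2-2\mu-2i\kappa\delta}\langle\Psi_{\mathrm d}^{(\alpha)}(\cdot,\lambda),f\rangle\Psi_{\mathrm d}^{(\alpha)}(\cdot,\lambda)\,d\lambda .$$ *)

theory Defs
  imports "HOL-Analysis.Analysis"
begin

section \<open>Square-integrable functions on the line\<close>

definition L2 :: "(real \<Rightarrow> complex) \<Rightarrow> bool" where
  "L2 f \<longleftrightarrow> f \<in> borel_measurable lborel \<and> integrable lborel (\<lambda>x. (norm (f x))\<^sup>2)"

definition L2_norm :: "(real \<Rightarrow> complex) \<Rightarrow> real" where
  "L2_norm f = sqrt (LINT x|lborel. (norm (f x))\<^sup>2)"

definition L2_inner :: "(real \<Rightarrow> complex) \<Rightarrow> (real \<Rightarrow> complex) \<Rightarrow> complex" where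
  "L2_inner f g = (LINT x|lborel. cnj (f x) * g x)"

definition japanese :: "real \<Rightarrow> real" where
  "japanese x = sqrt (1 + x\<^sup>2)"

definition weighted :: "real \<Rightarrow> (real \<Rightarrow> complex) \<Rightarrow> real \<Rightarrow> complex" where
  "weighted s f x = complex_of_real (japanese x powr s) * f x"


section \<open>Two-soliton eigenfunctions at time zero\<close>

text \<open>The parameters are \<open>\<rho> 1\<close>, \<open>\<rho> 2\<close>, \<open>\<theta> 1\<close>, \<open>\<theta> 2\<close>; other values of
  the functions \<open>\<rho>\<close> and \<open>\<theta>\<close> are never used.\<close>

definition ev :: "(nat \<Rightarrow> real) \<Rightarrow> nat \<Rightarrow> complex" where
  "ev \<rho> k = \<i> * complex_of_real (\<rho> k)"

definition gph :: "(nat \<Rightarrow> real) \<Rightarrow> nat \<Rightarrow> complex" where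
  "gph \<theta> k = exp (\<i> * complex_of_real (\<theta> k))"

definition dressing_system ::
  "(nat \<Rightarrow> real) \<Rightarrow> (nat \<Rightarrow> real) \<Rightarrow> real \<Rightarrow> complex \<times> complex \<times> complex \<times> complex \<Rightarrow> bool" where
  "dressing_system \<rho> \<theta> x = (\<lambda>(a0, a1, b0, b1). \<forall>k\<in>{1, 2}.
     ((ev \<rho> k)\<^sup>2 + a1 * ev \<rho> k + a0) * exp (- 2 * \<i> * ev \<rho> k * complex_of_real x)
       = cnj (gph \<theta> k) * (b1 * ev \<rho> k + b0) \<and>
     b1 * cnj (ev \<rho> k) + b0
       = - gph \<theta> k * ((cnj (ev \<rho> k))\<^sup>2 + a1 * cnj (ev \<rho> k) + a0)
           * exp (- 2 * \<i> * cnj (ev \<rho> k) * complex_of_real x))"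

text \<open>For \<open>0 < \<rho> 1 < \<rho> 2\<close> the system has exactly one solution.\<close>

definition dressing_coeffs ::
  "(nat \<Rightarrow> real) \<Rightarrow> (nat \<Rightarrow> real) \<Rightarrow> real \<Rightarrow> complex \<times> complex \<times> complex \<times> complex" where
  "dressing_coeffs \<rho> \<theta> x = (THE c. dressing_system \<rho> \<theta> x c)"

definition a_fun :: "(nat \<Rightarrow> real) \<Rightarrow> (nat \<Rightarrow> real) \<Rightarrow> real \<Rightarrow> complex \<Rightarrow> complex" where
  "a_fun \<rho> \<theta> x l = (case dressing_coeffs \<rho> \<theta> x of (a0, a1, b0, b1) \<Rightarrow>
     (l\<^sup>2 + a1 * l + a0) * exp (- 2 * \<i> * l * complex_of_real x))"

datatype parity = Ev | Od

definition Psi :: "(nat \<Rightarrow> real) \<Rightarrow> (nat \<Rightarrow> real) \<Rightarrow> parity \<Rightarrow> real \<Rightarrow> real \<Rightarrow> complex" where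
  "Psi \<rho> \<theta> \<alpha> x l =
     (case \<alpha> of
        Ev \<Rightarrow> a_fun \<rho> \<theta> x (complex_of_real l) + a_fun \<rho> \<theta> x (- complex_of_real l)
      | Od \<Rightarrow> a_fun \<rho> \<theta> x (complex_of_real l) - a_fun \<rho> \<theta> x (- complex_of_real l))
     / complex_of_real (sqrt (2 * pi * (l\<^sup>2 + (\<rho> 1)\<^sup>2) * (l\<^sup>2 + (\<rho> 2)\<^sup>2)))"

definition bound_state :: "(nat \<Rightarrow> real) \<Rightarrow> (nat \<Rightarrow> real) \<Rightarrow> nat \<Rightarrow> real \<Rightarrow> complex" where
  "bound_state \<rho> \<theta> k x = a_fun \<rho> \<theta> x (- \<i> * complex_of_real (\<rho> k))"

text \<open>The orthogonal projection onto the span of the two bound states; the span consists of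
  continuous functions, so the projection is unique as a function and not only almost everywhere.\<close>

definition bound_proj ::
  "(nat \<Rightarrow> real) \<Rightarrow> (nat \<Rightarrow> real) \<Rightarrow> (real \<Rightarrow> complex) \<Rightarrow> real \<Rightarrow> complex" where
  "bound_proj \<rho> \<theta> f = (THE g.
     (\<exists>c1 c2. g = (\<lambda>x. c1 * bound_state \<rho> \<theta> 1 x + c2 * bound_state \<rho> \<theta> 2 x)) \<and>
     (\<forall>k\<in>{1, 2}. L2_inner (bound_state \<rho> \<theta> k) (\<lambda>x. f x - g x) = 0))"


section \<open>Functions of the operator \<open>\<B>\<close>\<close>

text \<open>The operators \<open>\<B>\<close>, \<open>e\<^sup>-\<^sup>i\<^sup>t\<^sup>\<B>\<close>, the resolvents of \<open>\<B>\<close> and the projections onto the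
  even and odd continuous subspaces are all diagonal in the generalized eigenfunction expansion
    \[ f = \Pi f + \sum_\alpha \int_0^\infty
         \langle\Psi^{(\alpha)}(\cdot,\lambda),f\rangle\,\Psi^{(\alpha)}(x,\lambda)\,d\lambda . \]
  Each of them is therefore given by its symbol, i.e. the factor by which it multiplies each
  component of the expansion, and products of such operators by products of symbols.\<close>

datatype component = Bound | Cont parity real

definition B_symbol :: "real \<Rightarrow> component \<Rightarrow> complex" where
  "B_symbol \<beta> s = (case s of
     Bound \<Rightarrow> complex_of_real (- 2 * \<beta>) | Cont \<alpha> l \<Rightarrow> complex_of_real (2 * l\<^sup>2))"

definition resolvent_symbol :: "real \<Rightarrow> complex \<Rightarrow> component \<Rightarrow> complex" where
  "resolvent_symbol \<beta> z s = inverse (B_symbol \<beta> s - z)"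

definition evolution_symbol :: "real \<Rightarrow> real \<Rightarrow> component \<Rightarrow> complex" where
  "evolution_symbol \<beta> t s = exp (- \<i> * complex_of_real t * B_symbol \<beta> s)"

definition Pc_symbol :: "parity \<Rightarrow> component \<Rightarrow> complex" where
  "Pc_symbol \<alpha> s = (case s of Bound \<Rightarrow> 0 | Cont \<alpha>' l \<Rightarrow> (if \<alpha>' = \<alpha> then 1 else 0))"

text \<open>The integrals are Lebesgue integrals, evaluated at every \<open>x\<close>. This is the intended
  \<open>L\<^sup>2\<close>-sense integral when \<open>f\<close> is integrable and the symbol is \<open>O(\<lambda>\<^sup>-\<^sup>2)\<close> in \<open>Cont \<alpha> \<lambda>\<close>, as for
  a resolvent: the eigenfunctions are bounded, so everything converges absolutely. It then also
  selects the representative in which pointwise limits are meant.\<close>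

definition diag_op :: "(nat \<Rightarrow> real) \<Rightarrow> (nat \<Rightarrow> real) \<Rightarrow> (component \<Rightarrow> complex)
    \<Rightarrow> (real \<Rightarrow> complex) \<Rightarrow> real \<Rightarrow> complex" where
  "diag_op \<rho> \<theta> m f x =
     m Bound * bound_proj \<rho> \<theta> f x +
     (\<Sum>\<alpha>\<in>{Ev, Od}. LINT l:{0..}|lborel.
        m (Cont \<alpha> l) * L2_inner (\<lambda>y. Psi \<rho> \<theta> \<alpha> y l) f * Psi \<rho> \<theta> \<alpha> x l)"

definition resolvent_evolution_Pc :: "(nat \<Rightarrow> real) \<Rightarrow> (nat \<Rightarrow> real) \<Rightarrow> real \<Rightarrow> complex \<Rightarrow> real
    \<Rightarrow> parity \<Rightarrow> (real \<Rightarrow> complex) \<Rightarrow> real \<Rightarrow> complex" where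
  "resolvent_evolution_Pc \<rho> \<theta> \<beta> z t \<alpha> =
     diag_op \<rho> \<theta> (\<lambda>s. resolvent_symbol \<beta> z s * evolution_symbol \<beta> t s * Pc_symbol \<alpha> s)"

lemma resolvent_evolution_Pc_integral:
  "resolvent_evolution_Pc \<rho> \<theta> \<beta> (2 * complex_of_real \<mu> + 2 * \<i> * complex_of_real \<kappa> * complex_of_real \<delta>) t \<alpha> f x =
     (LINT l:{0..}|lborel.
        exp (- 2 * \<i> * complex_of_real (l\<^sup>2) * complex_of_real t)
          / (2 * complex_of_real (l\<^sup>2) - 2 * complex_of_real \<mu>
               - 2 * \<i> * complex_of_real \<kappa> * complex_of_real \<delta>)
        * L2_inner (\<lambda>y. Psi \<rho> \<theta> \<alpha> y l) f * Psi \<rho> \<theta> \<alpha> x l)"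
  by (cases \<alpha>)
     (simp_all add: resolvent_evolution_Pc_def diag_op_def resolvent_symbol_def
        evolution_symbol_def Pc_symbol_def B_symbol_def divide_inverse mult_ac diff_diff_eq)

end

(* The kernel of the resolvent evolution is an integral over [0, oo) of
     exp(-2i r l^2) / (2 (l^2 - mu - i delta)) * Psi(x, l) * conj(Psi(y, l)),
   and the product of eigenfunctions extends holomorphically in l to the strip |Im l| < rho_1. Put
   eps = c / (<x> <y>), so that the exponentials in the eigenfunctions stay bounded for |Im l| <= eps,
   and move the contour into the lower half plane: along the diagonal a - i a for 0 <= a <= eps, then
   along the horizontal line a - i eps. The pole lies above the new contour, so the limit delta -> 0
   can be taken under the integral. On the diagonal the oscillating factor becomes exp(-4 r a^2),
   which gives r^(-1/2), or r^(-3/2) in the odd case, where the product of eigenfunctions is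
   O(|l|^2). On the horizontal part it is exp(-4 r a eps) <= exp(-4 r eps^2) = O(eps^(-3) r^(-3/2)).
   In all, the kernel is bounded by a multiple of <x>^3 <y>^3 times the decay rate, and the
   assumption sigma > 7/2 says exactly that <x>^(3 - sigma) is square integrable. The case
   kappa = -1 follows by complex conjugation. *)
theory Submission
  imports Defs "HOL-Complex_Analysis.Complex_Analysis" "HOL-Probability.Sinc_Integral"
begin

section \<open>Integration\<close>

text \<open>The weight \<open><x>^3 <y>^3\<close> is the price of a factor
  \<open>\<epsilon>^(-3)\<close>, so no estimate may cost more than three powers of
  \<open>1 / \<epsilon>\<close>. The critical place is the horizontal line for positive
  \<open>\<mu>\<close>, which passes at distance \<open>\<epsilon>\<close> below the singularity at
  \<open>sqrt \<mu>\<close>. A Lorentzian of width \<open>\<epsilon>\<close> has integral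
  \<open>pi / \<epsilon>\<close>, and multiplied by the \<open>\<epsilon>^(-3)\<close> from the time
  decay this would be one power too many. But the singularity has real part at least
  \<open>2 * c\<close>, and beyond \<open>Re z = c\<close> the oscillating factor is at most
  \<open>exp (- 4 * r * c * \<epsilon>)\<close>, which gives the same rate for less than two powers.
  The integral of the Lorentzian does not depend on its centre, hence the uniformity in large
  \<open>\<mu>\<close>. The direction \<open>1 - \<i>\<close> of the diagonal makes
  \<open>z^2\<close> purely imaginary: the exponential becomes a real Gaussian, and the real part of
  \<open>z^2 - \<mu>\<close> is exactly \<open>- \<mu>\<close>. All bounds are uniform in
  \<open>\<delta>\<close>, so they also allow the limit to be taken inside the integral over
  \<open>y\<close>, and the limit function inherits them.\<close>

lemma norm_integral_le:
  fixes f :: "'a \<Rightarrow> 'b::{banach, second_countable_topology}"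
  assumes "integrable M g" and "\<And>x. norm (f x) \<le> g x"
  shows "norm (integral\<^sup>L M f) \<le> integral\<^sup>L M g"
proof (cases "integrable M f")
  case True
  have "norm (integral\<^sup>L M f) \<le> (LINT x|M. norm (f x))"
    by (rule integral_norm_bound)
  also have "\<dots> \<le> integral\<^sup>L M g"
    by (intro integral_mono integrable_norm True assms)
  finally show ?thesis .
next
  \<comment> \<open>A non-integrable function has integral \<open>0\<close> by convention, and
    \<open>g\<close> is nonnegative because it dominates a norm.\<close>
  case False
  moreover have "0 \<le> g x" for x
    using order_trans[OF norm_ge_zero assms(2)] .
  ultimately show ?thesis
    by (simp add: not_integrable_integral_eq)
qed

text \<open>A one-sided limit may be tested on sequences, where the usual dominated convergence
  theorem applies. Measurability of \<open>g\<close> comes along as that of a pointwise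
  limit.\<close>

lemma dominated_convergence_at_right:
  fixes s :: "real \<Rightarrow> 'a \<Rightarrow> complex"
  assumes meas: "\<And>\<delta>. \<delta> > 0 \<Longrightarrow> s \<delta> \<in> borel_measurable M"
    and w: "integrable M w"
    and lim: "\<And>x. ((\<lambda>\<delta>. s \<delta> x) \<longlongrightarrow> g x) (at_right 0)"
    and bound: "\<And>\<delta> x. \<delta> > 0 \<Longrightarrow> norm (s \<delta> x) \<le> w x"
  shows "((\<lambda>\<delta>. integral\<^sup>L M (s \<delta>)) \<longlongrightarrow> integral\<^sup>L M g) (at_right 0)"
proof (rule tendsto_at_right_sequentially[OF zero_less_one])
  fix S :: "nat \<Rightarrow> real"
  assume S: "\<And>n. 0 < S n" "S \<longlonglongrightarrow> 0"
  have "filterlim S (at_right 0) sequentially"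
    using S by (auto simp: filterlim_at intro!: always_eventually simp: less_imp_neq[symmetric])
  then have ptw: "(\<lambda>n. s (S n) x) \<longlonglongrightarrow> g x" for x
    by (rule filterlim_compose[OF lim])
  have g: "g \<in> borel_measurable M"
    by (rule borel_measurable_LIMSEQ_metric[OF meas[OF S(1)] ptw])
  show "(\<lambda>n. integral\<^sup>L M (s (S n))) \<longlonglongrightarrow> integral\<^sup>L M g"
    by (rule integral_dominated_convergence[OF g meas[OF S(1)] w])
       (use ptw bound S in auto)
qed

text \<open>The value does not depend on the centre \<open>p\<close>. Taken at
  \<open>p = sqrt \<bar>\<mu>\<bar>\<close>, this is the source of uniformity in
  \<open>\<mu>\<close>.\<close>

lemma has_bochner_integral_lorentzian:
  fixes c p :: real
  assumes "c > 0"
  shows "has_bochner_integral lborel (\<lambda>x. 1 / ((x - p)\<^sup>2 + c\<^sup>2)) (pi / c)"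
proof -
  have "integrable lborel (\<lambda>x::real. inverse (1 + x\<^sup>2))"
    using integrable_inverse_1_plus_square by (simp add: set_integrable_def)
  moreover have "(LINT x|lborel. inverse (1 + x\<^sup>2)) = pi"
    using LBINT_inverse_1_plus_square
    by (simp add: interval_lebesgue_integral_def set_lebesgue_integral_def)
  ultimately have "has_bochner_integral lborel (\<lambda>x::real. inverse (1 + x\<^sup>2)) pi"
    by (simp add: has_bochner_integral_iff)
  then have "has_bochner_integral lborel (\<lambda>x. inverse (1 + ((- p / c) + (1 / c) * x)\<^sup>2)) (pi /\<^sub>R \<bar>1 / c\<bar>)"
    using assms
    by (subst (asm) lborel_has_bochner_integral_real_affine_iff[where c = "1 / c" and t = "- p / c"]) auto
  then have "has_bochner_integral lborel
      (\<lambda>x. (1 / c\<^sup>2) * inverse (1 + ((- p / c) + (1 / c) * x)\<^sup>2)) ((1 / c\<^sup>2) * (pi /\<^sub>R \<bar>1 / c\<bar>))"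
    by (rule has_bochner_integral_mult_right)
  moreover have "(1 / c\<^sup>2) * inverse (1 + ((- p / c) + (1 / c) * x)\<^sup>2) = 1 / ((x - p)\<^sup>2 + c\<^sup>2)" for x
  proof -
    have "c\<^sup>2 * (1 + ((- p / c) + (1 / c) * x)\<^sup>2) = (x - p)\<^sup>2 + c\<^sup>2"
      using assms by (simp add: power2_eq_square field_simps)
    then show ?thesis
      by (metis inverse_eq_divide inverse_mult_distrib)
  qed
  ultimately show ?thesis
    using assms by (simp add: power2_eq_square)
qed

lemma has_vector_derivative_affine_compose:
  fixes \<Phi> :: "complex \<Rightarrow> complex" and c z :: complex and t :: real
  assumes "\<And>s. s \<in> {a..b} \<Longrightarrow> z + of_real s * c \<in> S"
    and "(\<Phi> has_field_derivative d) (at (z + of_real t * c) within S)"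
  shows "((\<lambda>s. \<Phi> (z + of_real s * c)) has_vector_derivative c * d) (at t within {a..b})"
proof -
  have 1: "((\<lambda>s. z + of_real s * c) has_vector_derivative c) (at t within {a..b})"
    by (auto intro!: derivative_eq_intros simp: has_vector_derivative_def scaleR_conv_of_real)
  have 2: "(\<Phi> has_field_derivative d) (at (z + of_real t * c) within (\<lambda>s. z + of_real s * c) ` {a..b})"
    by (rule DERIV_subset[OF assms(2)]) (use assms(1) in auto)
  show ?thesis
    using field_vector_diff_chain_within[OF 1 2] by (simp add: o_def)
qed

text \<open>The derivative of \<open>\<Phi>\<close> is taken within \<open>S\<close> because the
  segments of interest run along the boundary of the strip, where \<open>h\<close> will only be
  known to be continuous.\<close>

lemma line_integral_primitive:
  fixes \<Phi> h :: "complex \<Rightarrow> complex" and c z :: complex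
  assumes "a \<le> b" and S: "\<And>s. s \<in> {a..b} \<Longrightarrow> z + of_real s * c \<in> S"
    and \<Phi>: "\<And>w. w \<in> S \<Longrightarrow> (\<Phi> has_field_derivative h w) (at w within S)"
    and "continuous_on S h"
  shows "c * (LINT s:{a..b}|lborel. h (z + of_real s * c))
    = \<Phi> (z + of_real b * c) - \<Phi> (z + of_real a * c)"
proof -
  have c: "continuous_on {a..b} (\<lambda>s. h (z + of_real s * c))"
    by (rule continuous_on_compose2[OF assms(4)]) (use S in \<open>auto intro!: continuous_intros\<close>)
  have "(LINT s|lborel. indicator {a..b} s *\<^sub>R (c * h (z + of_real s * c)))
      = \<Phi> (z + of_real b * c) - \<Phi> (z + of_real a * c)"
    by (rule integral_FTC_Icc[OF \<open>a \<le> b\<close>])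
       (auto intro!: has_vector_derivative_affine_compose[where S=S] S \<Phi> continuous_intros c)
  then show ?thesis
    by (simp add: set_lebesgue_integral_def flip: integral_mult_right_zero mult_scaleR_right)
qed

section \<open>The shifted contour\<close>

definition strip :: "real \<Rightarrow> complex set" where
  "strip \<epsilon> = {z. 0 \<le> Re z \<and> - \<epsilon> \<le> Im z \<and> Im z \<le> 0}"

lemma convex_strip: "convex (strip \<epsilon>)"
proof -
  have "strip \<epsilon> = {z. Re z \<ge> 0} \<inter> {z. Im z \<ge> - \<epsilon>} \<inter> {z. Im z \<le> 0}"
    by (auto simp: strip_def)
  then show ?thesis
    by (auto intro!: convex_Int convex_halfspace_Re_ge convex_halfspace_Im_ge convex_halfspace_Im_le)
qed

lemma set_integrable_lorentzian_bound:
  fixes f :: "real \<Rightarrow> complex"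
  assumes "continuous_on {a..} f" and "\<And>x. x \<ge> a \<Longrightarrow> norm (f x) \<le> B / (1 + x\<^sup>2)"
  shows "set_integrable lborel {a..} f"
  unfolding set_integrable_def
proof (rule Bochner_Integration.integrable_bound)
  have "integrable lborel (\<lambda>x::real. 1 / ((x - 0)\<^sup>2 + 1\<^sup>2))"
    using has_bochner_integral_lorentzian[of 1 0] by (simp add: has_bochner_integral_iff)
  then show "integrable lborel (\<lambda>x. \<bar>B\<bar> * (1 / (1 + x\<^sup>2)))"
    by (intro integrable_mult_right) (simp add: add.commute)
  show "(\<lambda>x. indicat_real {a..} x *\<^sub>R f x) \<in> borel_measurable lborel"
    using borel_measurable_continuous_on_indicator[OF _ assms(1)] by simp
  have "norm (f x) \<le> \<bar>B\<bar> / (1 + x\<^sup>2)" if "x \<ge> a" for x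
    by (rule order_trans[OF assms(2)[OF that]]) (auto intro!: divide_right_mono)
  then show "AE x in lborel. norm (indicat_real {a..} x *\<^sub>R f x) \<le> norm (\<bar>B\<bar> * (1 / (1 + x\<^sup>2)))"
    by (auto split: split_indicator)
qed

text \<open>The convex strip carries a primitive \<open>\<Phi>\<close> of \<open>h\<close>, so every
  integral over a finite segment is a difference of two values of \<open>\<Phi>\<close>. What
  remains is the vertical segment at \<open>Re z = R\<close>; the quadratic decay of
  \<open>h\<close> makes it vanish as \<open>R\<close> grows and also makes both improper integrals
  converge.\<close>

lemma contour_shift:
  fixes h :: "complex \<Rightarrow> complex"
  assumes "\<epsilon> > 0" and cont: "continuous_on (strip \<epsilon>) h"
    and hol: "\<And>z. z \<in> interior (strip \<epsilon>) \<Longrightarrow> h field_differentiable at z"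
    and decay: "\<And>z. z \<in> strip \<epsilon> \<Longrightarrow> norm (h z) \<le> B / (1 + (Re z)\<^sup>2)"
  shows "(LINT l:{0..}|lborel. h (of_real l))
    = (1 - \<i>) * (LINT a:{0..\<epsilon>}|lborel. h (of_real a * (1 - \<i>)))
      + (LINT a:{\<epsilon>..}|lborel. h (of_real a - \<i> * of_real \<epsilon>))"
proof -
  obtain \<Phi> where \<Phi>: "\<And>z. z \<in> strip \<epsilon> \<Longrightarrow> (\<Phi> has_field_derivative h z) (at z within strip \<epsilon>)"
    using holomorphic_convex_primitive[OF convex_strip _ cont, of "{}"] hol by auto
  have B: "B \<ge> 0"
    using order_trans[OF norm_ge_zero decay[of 0]] \<open>\<epsilon> > 0\<close> by (simp add: strip_def)
  have real: "(LINT l:{0..R}|lborel. h (of_real l)) = \<Phi> (of_real R) - \<Phi> 0" if "R \<ge> 0" for R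
    using line_integral_primitive[OF that _ \<Phi> cont, of 0 1] \<open>\<epsilon> > 0\<close> by (auto simp: strip_def)
  have diag: "(1 - \<i>) * (LINT a:{0..\<epsilon>}|lborel. h (of_real a * (1 - \<i>)))
      = \<Phi> (of_real \<epsilon> * (1 - \<i>)) - \<Phi> 0"
    using line_integral_primitive[OF _ _ \<Phi> cont, of 0 \<epsilon> 0 "1 - \<i>"] \<open>\<epsilon> > 0\<close> by (auto simp: strip_def)
  have hor: "(LINT a:{\<epsilon>..R}|lborel. h (of_real a - \<i> * of_real \<epsilon>))
      = \<Phi> (of_real R - \<i> * of_real \<epsilon>) - \<Phi> (of_real \<epsilon> * (1 - \<i>))" if "R \<ge> \<epsilon>" for R
    using line_integral_primitive[OF that _ \<Phi> cont, of "- \<i> * of_real \<epsilon>" 1] \<open>\<epsilon> > 0\<close>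
    by (auto simp: strip_def algebra_simps)
  have ri: "set_integrable lborel {0..} (\<lambda>l. h (of_real l))"
    by (rule set_integrable_lorentzian_bound[where B=B])
       (use \<open>\<epsilon> > 0\<close> decay[of "of_real _"] in
         \<open>auto intro!: continuous_on_compose2[OF cont] continuous_intros simp: strip_def\<close>)
  have hi: "set_integrable lborel {\<epsilon>..} (\<lambda>a. h (of_real a - \<i> * of_real \<epsilon>))"
    by (rule set_integrable_lorentzian_bound[where B=B])
       (use \<open>\<epsilon> > 0\<close> decay[of "of_real _ - \<i> * of_real \<epsilon>"] in
         \<open>auto intro!: continuous_on_compose2[OF cont] continuous_intros simp: strip_def\<close>)
  have vert: "((\<lambda>R. \<Phi> (of_real R) - \<Phi> (of_real R - \<i> * of_real \<epsilon>)) \<longlongrightarrow> 0) at_top"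
  proof (rule Lim_null_comparison)
    show "\<forall>\<^sub>F R in at_top. norm (\<Phi> (of_real R) - \<Phi> (of_real R - \<i> * of_real \<epsilon>))
        \<le> B / (1 + R\<^sup>2) * \<epsilon>"
    proof (rule eventually_mono[OF eventually_ge_at_top[of 0]])
      fix R :: real assume R: "R \<ge> 0"
      \<comment> \<open>The vertical segment \<open>Re z = R\<close>, as a convex set. On it the
        bound for \<open>h\<close> is constant, so the mean value inequality suffices.\<close>
      define V where "V = strip \<epsilon> \<inter> ({z. Re z \<ge> R} \<inter> {z. Re z \<le> R})"
      have "convex V"
        unfolding V_def by (intro convex_Int convex_strip convex_halfspace_Re_ge convex_halfspace_Re_le)
      have "norm (\<Phi> (of_real R) - \<Phi> (of_real R - \<i> * of_real \<epsilon>))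
          \<le> B / (1 + R\<^sup>2) * norm (of_real R - (of_real R - \<i> * of_real \<epsilon>))"
      proof (rule field_differentiable_bound[OF \<open>convex V\<close>])
        show "(\<Phi> has_field_derivative h z) (at z within V)" if "z \<in> V" for z
          by (rule DERIV_subset[OF \<Phi>]) (use that in \<open>auto simp: V_def\<close>)
        show "norm (h z) \<le> B / (1 + R\<^sup>2)" if "z \<in> V" for z
          using decay[of z] that by (auto simp: V_def)
      qed (use R \<open>\<epsilon> > 0\<close> in \<open>auto simp: V_def strip_def\<close>)
      then show "norm (\<Phi> (of_real R) - \<Phi> (of_real R - \<i> * of_real \<epsilon>)) \<le> B / (1 + R\<^sup>2) * \<epsilon>"
        using \<open>\<epsilon> > 0\<close> by (simp add: norm_mult)
    qed
    have "((\<lambda>R. B / (1 + R\<^sup>2) * \<epsilon>) \<longlongrightarrow> 0 * \<epsilon>) at_top"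
      by (intro tendsto_mult tendsto_const tendsto_divide_0[OF tendsto_const]
          filterlim_at_top_imp_at_infinity filterlim_tendsto_add_at_top[OF tendsto_const]
          filterlim_pow_at_top filterlim_ident) auto
    then show "((\<lambda>R. B / (1 + R\<^sup>2) * \<epsilon>) \<longlongrightarrow> 0) at_top" by simp
  qed
  have "((\<lambda>R. (LINT l:{0..R}|lborel. h (of_real l))
        - (LINT a:{\<epsilon>..R}|lborel. h (of_real a - \<i> * of_real \<epsilon>)))
      \<longlongrightarrow> (LINT l:{0..}|lborel. h (of_real l))
        - (LINT a:{\<epsilon>..}|lborel. h (of_real a - \<i> * of_real \<epsilon>))) at_top"
    by (intro tendsto_diff tendsto_set_lebesgue_integral_at_top ri hi) auto
  moreover have "((\<lambda>R. (LINT l:{0..R}|lborel. h (of_real l))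
        - (LINT a:{\<epsilon>..R}|lborel. h (of_real a - \<i> * of_real \<epsilon>)))
      \<longlongrightarrow> 0 + (\<Phi> (of_real \<epsilon> * (1 - \<i>)) - \<Phi> 0)) at_top"
    by (rule Lim_transform_eventually[OF tendsto_add[OF vert tendsto_const]])
       (rule eventually_mono[OF eventually_ge_at_top[of \<epsilon>]], use \<open>\<epsilon> > 0\<close> in \<open>simp add: real hor\<close>)
  ultimately have "(LINT l:{0..}|lborel. h (of_real l))
        - (LINT a:{\<epsilon>..}|lborel. h (of_real a - \<i> * of_real \<epsilon>)) = \<Phi> (of_real \<epsilon> * (1 - \<i>)) - \<Phi> 0"
    by (simp add: LIM_unique tendsto_unique[OF trivial_limit_at_top_linorder])
  then show ?thesis
    unfolding diag by (simp only: diff_eq_eq)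
qed

section \<open>An oscillatory integral with a nearly real pole\<close>

text \<open>This follows from \<open>ln (1 + r * s) \<le> r * s\<close> and from
  \<open>s * (1 + r) \<le> 1 + r * s\<close>, where \<open>s \<le> 1\<close> enters. Powers of
  \<open>1 + r\<close> instead of \<open>r\<close> avoid a separate treatment of small
  times.\<close>

lemma exp_le_powr_three_halves:
  fixes s r :: real
  assumes "0 < s" "s \<le> 1" "0 \<le> r"
  shows "exp (- 4 * (r * s)) \<le> s powr (- 3 / 2) * (1 + r) powr (- 3 / 2)"
proof -
  have rs: "0 \<le> r * s" using assms by simp
  have "exp (- 4 * (r * s)) \<le> exp (- 3 / 2 * ln (1 + r * s))"
    using ln_add_one_self_le_self[OF rs] rs by simp
  also have "\<dots> = (1 + r * s) powr (- 3 / 2)"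
    using rs by (simp add: powr_def)
  also have "\<dots> \<le> (s * (1 + r)) powr (- 3 / 2)"
    using assms by (intro powr_mono2' mult_pos_pos) (auto simp: algebra_simps)
  also have "\<dots> = s powr (- 3 / 2) * (1 + r) powr (- 3 / 2)"
    using assms by (simp add: powr_mult)
  finally show ?thesis .
qed

text \<open>With \<open>u = r * a\<^sup>2\<close>, \<open>exp (4 * u)\<close> dominates
  \<open>(1 + u)\<^sup>2\<close>, and \<open>a \<le> 1\<close> gives
  \<open>1 + (1 + r) * a\<^sup>2 \<le> 2 * (1 + u)\<close>. The square is wanted because one factor
  will absorb the zero of \<open>G\<close> at \<open>0\<close> while the other remains as a
  Lorentzian in \<open>a\<close>.\<close>

lemma exp_le_rational_square:
  fixes a r :: real
  assumes "0 \<le> a" "a \<le> 1" "0 \<le> r"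
  shows "exp (- 4 * (r * a\<^sup>2)) \<le> 4 / (1 + (1 + r) * a\<^sup>2)\<^sup>2"
proof -
  have ra: "0 \<le> r * a\<^sup>2" and a2: "a\<^sup>2 \<le> 1" "0 \<le> a\<^sup>2"
    using assms by (auto simp: power_le_one)
  have "((1 + (1 + r) * a\<^sup>2) / 2)\<^sup>2 \<le> (1 + r * a\<^sup>2)\<^sup>2"
    using ra a2 by (intro power_mono) (auto simp: algebra_simps)
  also have "\<dots> \<le> (exp (r * a\<^sup>2))\<^sup>2"
    using ra by (intro power_mono exp_ge_add_one_self) auto
  also have "\<dots> \<le> exp (4 * (r * a\<^sup>2))"
    using ra by (simp add: flip: exp_of_nat_mult)
  finally have "(1 + (1 + r) * a\<^sup>2)\<^sup>2 / 4 \<le> exp (4 * (r * a\<^sup>2))"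
    by (simp add: power_divide)
  moreover have "0 < (1 + (1 + r) * a\<^sup>2)\<^sup>2"
    using assms by (intro zero_less_power add_pos_nonneg) auto
  ultimately show ?thesis
    by (simp add: exp_minus field_simps)
qed

text \<open>The diagonal bound has \<open>n = 1\<close> when \<open>G\<close> vanishes to second order at \<open>0\<close>, and is implied by the
  uniform bound when \<open>n = 0\<close>.\<close>

locale oscillatory_resolvent =
  fixes \<epsilon> c \<mu> r A :: real and n :: nat and G :: "complex \<Rightarrow> complex"
  assumes eps: "0 < \<epsilon>" "\<epsilon> \<le> c" "c \<le> 1" and mu: "4 * c\<^sup>2 \<le> \<bar>\<mu>\<bar>" and r: "0 \<le> r"
    and n: "n \<le> 1"
    and G_cont: "continuous_on (strip \<epsilon>) G"
    and G_hol: "\<And>z. z \<in> interior (strip \<epsilon>) \<Longrightarrow> G field_differentiable at z"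
    and G_bound: "\<And>z. z \<in> strip \<epsilon> \<Longrightarrow> norm (G z) \<le> A"
    and G_diag: "\<And>a. 0 \<le> a \<Longrightarrow> a \<le> \<epsilon> \<Longrightarrow> norm (G (of_real a * (1 - \<i>))) \<le> A / \<epsilon>^3 * (a\<^sup>2)^n"
begin

section \<open>The integrand on the half-strip at fixed \<open>\<delta>\<close>\<close>

definition q :: "real \<Rightarrow> complex \<Rightarrow> complex" where
  "q \<delta> z = z\<^sup>2 - of_real \<mu> - \<i> * of_real \<delta>"

definition h :: "real \<Rightarrow> complex \<Rightarrow> complex" where
  "h \<delta> z = exp (- 2 * \<i> * of_real r * z\<^sup>2) / (2 * q \<delta> z) * G z"

lemma A_nonneg: "0 \<le> A"
  using order_trans[OF norm_ge_zero G_bound[of 0]] eps by (simp add: strip_def)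

lemma c_pos: "0 < c" using eps by linarith

lemma Re_q: "Re (q \<delta> z) = (Re z)\<^sup>2 - (Im z)\<^sup>2 - \<mu>"
  and Im_q: "Im (q \<delta> z) = 2 * Re z * Im z - \<delta>"
  by (simp_all add: q_def power2_eq_square)

text \<open>For \<open>Re z \<ge> 0\<close> and \<open>Im z \<le> 0\<close> both terms of
  \<open>Im (q \<delta> z)\<close> are nonpositive and cannot cancel. This is why the contour goes
  down: no pole is crossed and no residue appears.\<close>

lemma q_strip_nonzero:
  assumes "\<delta> > 0" "z \<in> strip \<epsilon>"
  shows "\<delta> \<le> norm (q \<delta> z)"
proof -
  have "2 * Re z * Im z \<le> 0"
    using assms by (auto simp: strip_def mult_nonneg_nonpos)
  then show ?thesis
    using abs_Im_le_cmod[of "q \<delta> z"] assms unfolding Im_q by linarith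
qed

lemma norm_h: "norm (h \<delta> z) = exp (4 * r * Re z * Im z) / (2 * norm (q \<delta> z)) * norm (G z)"
  by (simp add: h_def norm_mult norm_divide power2_eq_square algebra_simps)

lemma h_cont: "\<delta> > 0 \<Longrightarrow> continuous_on (strip \<epsilon>) (h \<delta>)"
proof -
  assume \<delta>: "\<delta> > 0"
  have "2 * q \<delta> z \<noteq> 0" if "z \<in> strip \<epsilon>" for z
    using q_strip_nonzero[OF \<delta> that] \<delta> by auto
  moreover have "continuous_on (strip \<epsilon>) (\<lambda>z. 2 * q \<delta> z)"
    unfolding q_def by (intro continuous_intros)
  moreover have "continuous_on (strip \<epsilon>) (\<lambda>z. exp (- 2 * \<i> * of_real r * z\<^sup>2))"
    by (intro continuous_intros)
  ultimately show ?thesis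
    unfolding h_def by (intro continuous_on_mult[OF continuous_on_divide] G_cont) blast+
qed

lemma h_hol:
  assumes "\<delta> > 0" "z \<in> interior (strip \<epsilon>)"
  shows "h \<delta> field_differentiable at z"
proof -
  have "q \<delta> z \<noteq> 0"
    using q_strip_nonzero[OF assms(1), of z] assms interior_subset by force
  moreover have "q \<delta> field_differentiable at z"
    unfolding q_def by (intro derivative_intros)
  moreover have "(\<lambda>z. exp (- 2 * \<i> * of_real r * z\<^sup>2)) field_differentiable at z"
    by (rule holomorphic_on_imp_differentiable_at[of _ UNIV]) (auto intro!: holomorphic_intros)
  ultimately show ?thesis
    unfolding h_def by (intro derivative_intros G_hol assms) auto
qed

text \<open>The constant blows up as \<open>\<delta>\<close> tends to \<open>0\<close>; it only
  justifies the contour shift at fixed \<open>\<delta>\<close>. Up to an additive constant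
  \<open>1 + (Re z)\<^sup>2\<close> is bounded by \<open>norm (q \<delta> z)\<close>, and that
  constant is absorbed through \<open>\<delta> \<le> norm (q \<delta> z)\<close>.\<close>

lemma h_decay:
  assumes "\<delta> > 0"
  obtains B where "\<And>z. z \<in> strip \<epsilon> \<Longrightarrow> norm (h \<delta> z) \<le> B / (1 + (Re z)\<^sup>2)"
proof
  fix z assume z: "z \<in> strip \<epsilon>"
  define K where "K = 1 + (1 + \<epsilon>\<^sup>2 + \<bar>\<mu>\<bar>) / \<delta>"
  have q: "\<delta> \<le> norm (q \<delta> z)" by (rule q_strip_nonzero[OF assms z])
  have "(Im z)\<^sup>2 \<le> \<epsilon>\<^sup>2"
    using z by (intro power2_le_iff_abs_le[THEN iffD2]) (use eps in \<open>auto simp: strip_def\<close>)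
  then have "1 + (Re z)\<^sup>2 \<le> norm (q \<delta> z) + (1 + \<epsilon>\<^sup>2 + \<bar>\<mu>\<bar>)"
    using abs_Re_le_cmod[of "q \<delta> z"] unfolding Re_q by linarith
  also have "1 + \<epsilon>\<^sup>2 + \<bar>\<mu>\<bar> \<le> (1 + \<epsilon>\<^sup>2 + \<bar>\<mu>\<bar>) / \<delta> * norm (q \<delta> z)"
    using q assms mult_left_mono[OF q, of "(1 + \<epsilon>\<^sup>2 + \<bar>\<mu>\<bar>) / \<delta>"] by simp
  finally have K: "1 + (Re z)\<^sup>2 \<le> K * norm (q \<delta> z)"
    by (simp add: K_def algebra_simps)
  have q0: "0 < norm (q \<delta> z)" using q assms by linarith
  have pos: "0 < 1 + (Re z)\<^sup>2" by (simp add: add_pos_nonneg)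
  have "exp (4 * r * Re z * Im z) \<le> 1"
    using z r by (simp add: strip_def mult_nonneg_nonpos)
  then have "norm (h \<delta> z) \<le> 1 / (2 * norm (q \<delta> z)) * A"
    unfolding norm_h by (intro mult_mono divide_right_mono G_bound z) (use A_nonneg in auto)
  also have "\<dots> \<le> 1 / norm (q \<delta> z) * A"
    using A_nonneg q0 by (intro mult_right_mono) (auto simp: field_simps)
  also have "1 / norm (q \<delta> z) \<le> K / (1 + (Re z)\<^sup>2)"
    using K q0 pos by (simp add: field_simps)
  finally show "norm (h \<delta> z) \<le> (1 + (1 + \<epsilon>\<^sup>2 + \<bar>\<mu>\<bar>) / \<delta>) * A / (1 + (Re z)\<^sup>2)"
    using A_nonneg by (simp add: K_def mult_right_mono)
qed

text \<open>The square of \<open>a * (1 - \<i>)\<close> is purely imaginary, so the real part of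
  \<open>q\<close> is \<open>- \<mu>\<close> for every \<open>a\<close>.\<close>

lemma q_diag: 
  assumes "\<delta> \<ge> 0" 
  shows "4 * c\<^sup>2 \<le> norm (q \<delta> (of_real a * (1 - \<i>)))"
  using abs_Re_le_cmod[of "q \<delta> (of_real a * (1 - \<i>))"] mu unfolding Re_q by simp

text \<open>The square of this point has real part between \<open>0\<close> and
  \<open>c\<^sup>2\<close>, too small to come close to \<open>\<mu>\<close>.\<close>

lemma q_near:
  assumes "\<epsilon> \<le> a" "a \<le> c"
  shows "c\<^sup>2 \<le> norm (q \<delta> (of_real a - \<i> * of_real \<epsilon>))"
proof -
  have "a\<^sup>2 \<le> c\<^sup>2" "\<epsilon>\<^sup>2 \<le> a\<^sup>2" "0 \<le> \<epsilon>\<^sup>2"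
    using assms eps by (auto intro: power_mono)
  then have "c\<^sup>2 \<le> \<bar>a\<^sup>2 - \<epsilon>\<^sup>2 - \<mu>\<bar>"
    using mu by arith
  then show ?thesis
    using abs_Re_le_cmod[of "q \<delta> (of_real a - \<i> * of_real \<epsilon>)"] unfolding Re_q by simp
qed

text \<open>For \<open>\<mu> = p\<^sup>2\<close>, factor \<open>z\<^sup>2 - \<mu>\<close> as
  \<open>(z - p) * (z + p)\<close> at \<open>z = a - \<i> * \<epsilon>\<close>: the second factor
  has modulus at least \<open>a\<close>, the first is the square root of the Lorentzian denominator.
  A positive \<open>\<delta>\<close> only enlarges the imaginary part. For negative
  \<open>\<mu>\<close> there is no singularity and \<open>1 / a\<^sup>2\<close> alone
  suffices.\<close>

lemma inverse_q_far:
  assumes "c \<le> a" "\<delta> \<ge> 0"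
  shows "q \<delta> (of_real a - \<i> * of_real \<epsilon>) \<noteq> 0"
    and "1 / norm (q \<delta> (of_real a - \<i> * of_real \<epsilon>)) \<le> 1 / a\<^sup>2 + 1 / ((a - sqrt \<bar>\<mu>\<bar>)\<^sup>2 + \<epsilon>\<^sup>2)"
proof -
  let ?q = "q \<delta> (of_real a - \<i> * of_real \<epsilon>)"
  have a: "0 < a" using assms c_pos by linarith
  define X where "X = (a - sqrt \<bar>\<mu>\<bar>)\<^sup>2 + \<epsilon>\<^sup>2"
  have X: "0 < X" using eps by (simp add: X_def add_nonneg_pos)
  have "0 < norm ?q \<and> 1 / norm ?q \<le> 1 / a\<^sup>2 + 1 / X"
  proof (cases "\<mu> \<ge> 0")
    case False
    have "\<epsilon>\<^sup>2 \<le> c\<^sup>2" "0 \<le> c\<^sup>2" using eps by (auto intro: power_mono)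
    then have q: "a\<^sup>2 \<le> norm ?q"
      using abs_Re_le_cmod[of ?q] mu False unfolding Re_q by simp
    have a2: "0 < a\<^sup>2" using a by simp
    then have "0 < norm ?q" using q by linarith
    moreover have "1 / norm ?q \<le> 1 / a\<^sup>2"
      using q a2 \<open>0 < norm ?q\<close> by (intro divide_left_mono mult_pos_pos) auto
    moreover have "0 < 1 / X" using X by simp
    ultimately show ?thesis by linarith
  next
    case True
    define p where "p = sqrt \<mu>"
    have p: "0 \<le> p" "\<mu> = p\<^sup>2" using True by (auto simp: p_def)
    have "X * a\<^sup>2 \<le> X * ((a + p)\<^sup>2 + \<epsilon>\<^sup>2)"
      using X a p power_mono[of a "a + p" 2] by (intro mult_left_mono add_increasing2) auto
    also have "\<dots> = (a\<^sup>2 - \<epsilon>\<^sup>2 - \<mu>)\<^sup>2 + (2 * a * \<epsilon>)\<^sup>2"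
      unfolding X_def using True by (simp add: p(2)) (simp add: power2_eq_square algebra_simps p(1))
    also have "\<dots> \<le> (a\<^sup>2 - \<epsilon>\<^sup>2 - \<mu>)\<^sup>2 + (2 * a * \<epsilon> + \<delta>)\<^sup>2"
      using a eps assms by (intro add_left_mono power_mono) auto
    also have "\<dots> = (norm ?q)\<^sup>2"
      by (simp add: cmod_power2 Re_q Im_q) (simp add: power2_eq_square algebra_simps)
    finally have le: "X * a\<^sup>2 \<le> (norm ?q)\<^sup>2" .
    then have "sqrt X * a \<le> norm ?q"
      using X by - (rule power2_le_imp_le, simp_all add: power_mult_distrib)
    moreover have sa: "0 < sqrt X * a" using X a by simp
    ultimately have "1 / norm ?q \<le> 1 / (sqrt X * a)"
      by (intro divide_left_mono) (auto intro!: mult_pos_pos)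
    also have "\<dots> \<le> 1 / a\<^sup>2 + 1 / X"
    proof -
      \<comment> \<open>The inequality of arithmetic and geometric means separates the singularity
        at \<open>sqrt \<mu>\<close> from the decay at infinity, so that the two can be integrated
        independently of each other.\<close>
      have "0 \<le> (1 / sqrt X - 1 / a)\<^sup>2" by simp
      also have "\<dots> = 1 / a\<^sup>2 + 1 / X - 2 * (1 / (sqrt X * a))"
        using X by (simp add: power2_diff power_divide)
      moreover have "0 < 1 / (sqrt X * a)" using sa by simp
      ultimately show ?thesis by linarith
    qed
    finally show ?thesis using sa \<open>sqrt X * a \<le> norm ?q\<close> by linarith
  qed
  then show "?q \<noteq> 0" "1 / norm ?q \<le> 1 / a\<^sup>2 + 1 / ((a - sqrt \<bar>\<mu>\<bar>)\<^sup>2 + \<epsilon>\<^sup>2)"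
    by (auto simp: X_def)
qed

lemma q_horizontal_nonzero:
  assumes "\<epsilon> \<le> a" "\<delta> \<ge> 0"
  shows "q \<delta> (of_real a - \<i> * of_real \<epsilon>) \<noteq> 0"
proof (cases "a \<le> c")
  case True
  then show ?thesis using q_near[OF assms(1) True, of \<delta>] c_pos by auto
next
  case False
  then show ?thesis using inverse_q_far(1)[of a \<delta>] assms by auto
qed

text \<open>The first summand dominates for \<open>\<epsilon> \<le> a \<le> c\<close>, away from the singularity at \<open>\<surd>\<bar>\<mu>\<bar> \<ge> 2 * c\<close>;
  beyond \<open>c\<close> the better decay \<open>exp (- 4 * r * c * \<epsilon>)\<close> compensates the factor \<open>pi / \<epsilon>\<close> from
  integrating the Lorentzian at that singularity.\<close>

definition bound_horizontal :: "real \<Rightarrow> real" where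
  "bound_horizontal a = A / 2 * (1 + r) powr (- 3 / 2) *
     (2 / \<epsilon>^3 * (1 / ((a - 0)\<^sup>2 + c\<^sup>2)) + 1 / (c * \<epsilon>)\<^sup>2 * (1 / ((a - sqrt \<bar>\<mu>\<bar>)\<^sup>2 + \<epsilon>\<^sup>2)))"

lemma norm_h_horizontal:
  assumes "\<epsilon> \<le> a" "\<delta> \<ge> 0"
  shows "norm (h \<delta> (of_real a - \<i> * of_real \<epsilon>)) \<le> bound_horizontal a"
proof -
  let ?z = "of_real a - \<i> * of_real \<epsilon>"
  define R where "R = (1 + r) powr (- 3 / 2)"
  define X where "X = 1 / ((a - sqrt \<bar>\<mu>\<bar>)\<^sup>2 + \<epsilon>\<^sup>2)"
  \<comment> \<open>\<open>2 * Y\<close> dominates \<open>1 / c\<^sup>2\<close> for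
    \<open>a \<le> c\<close> and \<open>1 / a\<^sup>2\<close> for \<open>a \<ge> c\<close>, so one
    Lorentzian centred at \<open>0\<close> serves both ranges.\<close>
  define Y where "Y = 1 / (a\<^sup>2 + c\<^sup>2)"
  have a: "0 < a" using assms eps by linarith
  have z: "?z \<in> strip \<epsilon>" using a eps by (simp add: strip_def)
  have XY: "0 \<le> X" "0 \<le> Y" "0 \<le> R" by (simp_all add: X_def Y_def R_def)
  \<comment> \<open>On the whole line \<open>a * \<epsilon> \<ge> \<epsilon>\<^sup>2\<close>, and
    \<open>s = \<epsilon>\<^sup>2\<close> costs the full three powers of
    \<open>1 / \<epsilon>\<close>.\<close>
  have e1: "exp (- 4 * (r * (a * \<epsilon>))) \<le> 1 / \<epsilon>^3 * R"
  proof -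
    have "r * \<epsilon>\<^sup>2 \<le> r * (a * \<epsilon>)"
      using assms eps r by (intro mult_left_mono) (auto simp: power2_eq_square)
    then have "exp (- 4 * (r * (a * \<epsilon>))) \<le> exp (- 4 * (r * \<epsilon>\<^sup>2))"
      by simp
    also have "\<dots> \<le> (\<epsilon>\<^sup>2) powr (- 3 / 2) * R"
      unfolding R_def by (intro exp_le_powr_three_halves) (use eps r in \<open>auto simp: power_le_one\<close>)
    also have "(\<epsilon>\<^sup>2) powr (- 3 / 2) = \<epsilon> powr (- 3)"
      using eps powr_powr[of \<epsilon> 2 "- 3 / 2"] by simp
    also have "\<dots> = 1 / \<epsilon>^3"
      using eps by (simp add: powr_minus_divide)
    finally show ?thesis .
  qed
  \<comment> \<open>Here \<open>s = c * \<epsilon>\<close> costs only the power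
    \<open>3 / 2\<close>, rounded up to \<open>2\<close>; with the factor
    \<open>pi / \<epsilon>\<close> from the integral of \<open>X\<close> the total is again
    \<open>\<epsilon>^(-3)\<close>.\<close>
  have e2: "exp (- 4 * (r * (a * \<epsilon>))) \<le> 1 / (c * \<epsilon>)\<^sup>2 * R" if "c \<le> a"
  proof -
    have ce: "0 < c * \<epsilon>" "c * \<epsilon> \<le> 1" using eps c_pos by (auto intro: mult_le_one)
    have "r * (c * \<epsilon>) \<le> r * (a * \<epsilon>)"
      using that eps r by (intro mult_left_mono mult_right_mono) auto
    then have "exp (- 4 * (r * (a * \<epsilon>))) \<le> exp (- 4 * (r * (c * \<epsilon>)))"
      by simp
    also have "\<dots> \<le> (c * \<epsilon>) powr (- 3 / 2) * R"
      unfolding R_def by (intro exp_le_powr_three_halves) (use ce r in auto)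
    also have "\<dots> \<le> (c * \<epsilon>) powr (- 2) * R"
      using ce XY by (intro mult_right_mono powr_mono') auto
    also have "(c * \<epsilon>) powr (- 2) = 1 / (c * \<epsilon>)\<^sup>2"
      using ce by (simp add: powr_minus_divide)
    finally show ?thesis .
  qed
  have h: "norm (h \<delta> ?z) \<le> exp (- 4 * (r * (a * \<epsilon>))) * (1 / norm (q \<delta> ?z)) * (A / 2)"
  proof -
    have "norm (h \<delta> ?z) = exp (- 4 * (r * (a * \<epsilon>))) * (1 / norm (q \<delta> ?z)) * (norm (G ?z) / 2)"
      by (simp add: norm_h mult_ac)
    also have "\<dots> \<le> exp (- 4 * (r * (a * \<epsilon>))) * (1 / norm (q \<delta> ?z)) * (A / 2)"
      using G_bound[OF z] by (intro mult_left_mono) auto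
    finally show ?thesis .
  qed
  have "exp (- 4 * (r * (a * \<epsilon>))) * (1 / norm (q \<delta> ?z)) \<le> 1 / \<epsilon>^3 * R * (2 * Y) + 1 / (c * \<epsilon>)\<^sup>2 * R * X"
  proof (cases "a \<le> c")
    case True
    have "a\<^sup>2 \<le> c\<^sup>2" using True a by (intro power_mono) auto
    have c2: "0 < c\<^sup>2" using c_pos by simp
    have "1 / norm (q \<delta> ?z) \<le> 1 / c\<^sup>2"
      using q_near[OF assms(1) True, of \<delta>] c2 by (intro divide_left_mono) (auto intro!: mult_pos_pos)
    also have "\<dots> \<le> 2 * Y"
      using \<open>a\<^sup>2 \<le> c\<^sup>2\<close> c2 by (simp add: Y_def divide_simps add_nonneg_pos)
    finally have "exp (- 4 * (r * (a * \<epsilon>))) * (1 / norm (q \<delta> ?z)) \<le> 1 / \<epsilon>^3 * R * (2 * Y)"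
      using eps XY by (intro mult_mono e1) auto
    then show ?thesis using XY by (auto intro: add_increasing2)
  next
    case False
    then have ca: "c \<le> a" by simp
    have "a\<^sup>2 \<ge> c\<^sup>2" using ca c_pos by (intro power_mono) auto
    then have "1 / a\<^sup>2 \<le> 2 * Y"
      using a by (simp add: Y_def divide_simps add_pos_nonneg)
    then have "exp (- 4 * (r * (a * \<epsilon>))) * (1 / norm (q \<delta> ?z)) \<le> exp (- 4 * (r * (a * \<epsilon>))) * (2 * Y + X)"
      using inverse_q_far(2)[OF ca assms(2)] by (intro mult_left_mono) (auto simp: X_def)
    also have "\<dots> = exp (- 4 * (r * (a * \<epsilon>))) * (2 * Y) + exp (- 4 * (r * (a * \<epsilon>))) * X"
      by (simp add: algebra_simps)
    also have "\<dots> \<le> 1 / \<epsilon>^3 * R * (2 * Y) + 1 / (c * \<epsilon>)\<^sup>2 * R * X"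
      using XY by (intro add_mono mult_right_mono e1 e2 ca) auto
    finally show ?thesis .
  qed
  then have "norm (h \<delta> ?z) \<le> (1 / \<epsilon>^3 * R * (2 * Y) + 1 / (c * \<epsilon>)\<^sup>2 * R * X) * (A / 2)"
    using A_nonneg by (intro order_trans[OF h] mult_right_mono) auto
  also have "\<dots> = bound_horizontal a"
    by (simp add: bound_horizontal_def R_def X_def Y_def algebra_simps)
  finally show ?thesis .
qed

lemma bound_horizontal_integral:
  "has_bochner_integral lborel bound_horizontal
     (A / 2 * (1 + r) powr (- 3 / 2) * (2 / \<epsilon>^3 * (pi / c) + 1 / (c * \<epsilon>)\<^sup>2 * (pi / \<epsilon>)))"
  unfolding bound_horizontal_def
  by (intro has_bochner_integral_mult_right has_bochner_integral_add has_bochner_integral_lorentzian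
      eps c_pos)

text \<open>A Lorentzian of width \<open>1 / sqrt (1 + r)\<close>. Its integral returns a factor
  \<open>pi * sqrt (1 + r)\<close>, so the prefactor with \<open>(1 + r)^(n + 1)\<close> leaves the
  rate \<open>(1 + r) powr (- (n + 1 / 2))\<close>.\<close>

definition bound_diag :: "real \<Rightarrow> real" where
  "bound_diag a = A / (2 * c\<^sup>2 * \<epsilon>^3 * (1 + r)^(n + 1)) * (1 / ((a - 0)\<^sup>2 + (1 / sqrt (1 + r))\<^sup>2))"

lemma norm_h_diag:
  assumes "0 \<le> a" "a \<le> \<epsilon>" "\<delta> \<ge> 0"
  shows "norm (h \<delta> (of_real a * (1 - \<i>))) \<le> bound_diag a"
proof -
  let ?z = "of_real a * (1 - \<i>)"
  define R where "R = 1 + r"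
  have R: "0 < R" using r by (simp add: R_def)
  have c2: "0 < c\<^sup>2" using c_pos by simp
  define w where "w = 1 + R * a\<^sup>2"
  have w: "1 \<le> w" using R by (simp add: w_def)
  have "norm (h \<delta> ?z) = exp (- 4 * (r * a\<^sup>2)) / (2 * norm (q \<delta> ?z)) * norm (G ?z)"
    by (simp add: norm_h power2_eq_square)
  also have "\<dots> \<le> 4 / w\<^sup>2 / (2 * (4 * c\<^sup>2)) * (A / \<epsilon>^3 * (a\<^sup>2)^n)"
    unfolding w_def R_def
    by (intro mult_mono frac_le exp_le_rational_square G_diag q_diag)
       (use assms eps r c2 q_diag[of \<delta> a] in auto)
  also have "\<dots> = A / (2 * c\<^sup>2 * \<epsilon>^3) * ((a\<^sup>2)^n / w\<^sup>2)"
    by (simp add: field_simps)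
  also have "\<dots> \<le> A / (2 * c\<^sup>2 * \<epsilon>^3) * (1 / (R^n * w))"
  proof (rule mult_left_mono)
    \<comment> \<open>One factor \<open>w\<close> trades the zero of \<open>G\<close> for the gain
      \<open>1 / R^n\<close>; this is where \<open>n \<le> 1\<close> enters.\<close>
    have "(R * a\<^sup>2)^n \<le> w"
      using n w by (cases n) (auto simp: w_def)
    then have "(a\<^sup>2)^n * (R^n * w) \<le> w * w"
      using w by (simp add: power_mult_distrib mult_ac)
    then show "(a\<^sup>2)^n / w\<^sup>2 \<le> 1 / (R^n * w)"
      using w R by (simp add: divide_simps power2_eq_square)
    show "0 \<le> A / (2 * c\<^sup>2 * \<epsilon>^3)" using A_nonneg eps by auto
  qed
  also have "1 / (R^n * w) = 1 / R^(n+1) * (1 / ((a - 0)\<^sup>2 + (1 / sqrt R)\<^sup>2))"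
  proof -
    have "w = R * ((a - 0)\<^sup>2 + (1 / sqrt R)\<^sup>2)"
      using R by (simp add: w_def power_divide algebra_simps)
    then show ?thesis by simp
  qed
  finally show ?thesis by (simp add: bound_diag_def R_def)
qed

lemma bound_diag_integral:
  "has_bochner_integral lborel bound_diag
     (A / (2 * c\<^sup>2 * \<epsilon>^3 * (1 + r)^(n + 1)) * (pi / (1 / sqrt (1 + r))))"
  unfolding bound_diag_def using r
  by (intro has_bochner_integral_mult_right has_bochner_integral_lorentzian) auto

section \<open>The limit of vanishing \<open>\<delta>\<close> on the shifted contour\<close>

lemma h_tendsto:
  assumes "q 0 z \<noteq> 0"
  shows "((\<lambda>\<delta>. h \<delta> z) \<longlongrightarrow> h 0 z) (at_right 0)"
proof -
  have "((\<lambda>\<delta>. z\<^sup>2 - of_real \<mu> - \<i> * of_real \<delta>) \<longlongrightarrow> z\<^sup>2 - of_real \<mu> - \<i> * of_real 0) (at_right 0)"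
    by (intro tendsto_intros)
  then show ?thesis
    using assms unfolding h_def q_def by (intro tendsto_intros) auto
qed

text \<open>The majorant does not involve \<open>\<delta>\<close>, so it yields the limit and the
  norm bound together. It is integrated over the whole line, where its integral is explicit.\<close>

lemma diag_part:
  shows "((\<lambda>\<delta>. LINT a:{0..\<epsilon>}|lborel. h \<delta> (of_real a * (1 - \<i>)))
      \<longlongrightarrow> (LINT a:{0..\<epsilon>}|lborel. h 0 (of_real a * (1 - \<i>)))) (at_right 0)" (is ?lim)
    and "\<delta> > 0 \<Longrightarrow> norm (LINT a:{0..\<epsilon>}|lborel. h \<delta> (of_real a * (1 - \<i>)))
      \<le> A / (2 * c\<^sup>2 * \<epsilon>^3 * (1 + r)^(n + 1)) * (pi / (1 / sqrt (1 + r)))" (is "_ \<Longrightarrow> ?bound")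
proof -
  have int: "integrable lborel bound_diag" "integral\<^sup>L lborel bound_diag
      = A / (2 * c\<^sup>2 * \<epsilon>^3 * (1 + r)^(n + 1)) * (pi / (1 / sqrt (1 + r)))"
    using bound_diag_integral by (auto simp: has_bochner_integral_iff)
  have nonneg: "0 \<le> bound_diag a" for a
    using A_nonneg eps r by (auto simp: bound_diag_def intro!: mult_nonneg_nonneg divide_nonneg_nonneg)
  have bound: "norm (indicator {0..\<epsilon>} a *\<^sub>R h \<delta> (of_real a * (1 - \<i>))) \<le> bound_diag a"
    if "\<delta> > 0" for \<delta> a
    using norm_h_diag[of a \<delta>] nonneg that by (auto split: split_indicator)
  show ?lim
    unfolding set_lebesgue_integral_def
  proof (rule dominated_convergence_at_right[OF _ int(1)])
    fix \<delta> :: real assume "\<delta> > 0"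
    then have "continuous_on {0..\<epsilon>} (\<lambda>a. h \<delta> (of_real a * (1 - \<i>)))"
      by (intro continuous_on_compose2[OF h_cont] continuous_intros) (auto simp: strip_def)
    then show "(\<lambda>a. indicator {0..\<epsilon>} a *\<^sub>R h \<delta> (of_real a * (1 - \<i>))) \<in> borel_measurable lborel"
      using borel_measurable_continuous_on_indicator[of "{0..\<epsilon>}"] by simp
  next
    fix a
    have "q 0 (of_real a * (1 - \<i>)) \<noteq> 0"
      using q_diag[of 0 a] c_pos by auto
    then show "((\<lambda>\<delta>. indicator {0..\<epsilon>} a *\<^sub>R h \<delta> (of_real a * (1 - \<i>)))
        \<longlongrightarrow> indicator {0..\<epsilon>} a *\<^sub>R h 0 (of_real a * (1 - \<i>))) (at_right 0)"
      by (intro tendsto_intros h_tendsto)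
  qed (rule bound)
  show ?bound if "\<delta> > 0"
    unfolding set_lebesgue_integral_def int(2)[symmetric]
    by (rule norm_integral_le) (use bound[OF that] int in auto)
qed

lemma horizontal_part:
  shows "((\<lambda>\<delta>. LINT a:{\<epsilon>..}|lborel. h \<delta> (of_real a - \<i> * of_real \<epsilon>))
      \<longlongrightarrow> (LINT a:{\<epsilon>..}|lborel. h 0 (of_real a - \<i> * of_real \<epsilon>))) (at_right 0)" (is ?lim)
    and "\<delta> > 0 \<Longrightarrow> norm (LINT a:{\<epsilon>..}|lborel. h \<delta> (of_real a - \<i> * of_real \<epsilon>))
      \<le> A / 2 * (1 + r) powr (- 3 / 2) * (2 / \<epsilon>^3 * (pi / c) + 1 / (c * \<epsilon>)\<^sup>2 * (pi / \<epsilon>))"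
      (is "_ \<Longrightarrow> ?bound")
proof -
  have int: "integrable lborel bound_horizontal" "integral\<^sup>L lborel bound_horizontal
      = A / 2 * (1 + r) powr (- 3 / 2) * (2 / \<epsilon>^3 * (pi / c) + 1 / (c * \<epsilon>)\<^sup>2 * (pi / \<epsilon>))"
    using bound_horizontal_integral by (auto simp: has_bochner_integral_iff)
  have nonneg: "0 \<le> bound_horizontal a" for a
    using A_nonneg eps r
    by (auto simp: bound_horizontal_def intro!: mult_nonneg_nonneg add_nonneg_nonneg divide_nonneg_nonneg)
  have bound: "norm (indicator {\<epsilon>..} a *\<^sub>R h \<delta> (of_real a - \<i> * of_real \<epsilon>)) \<le> bound_horizontal a"
    if "\<delta> > 0" for \<delta> a
    using norm_h_horizontal[of a \<delta>] nonneg that by (auto split: split_indicator)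
  show ?lim
    unfolding set_lebesgue_integral_def
  proof (rule dominated_convergence_at_right[OF _ int(1)])
    fix \<delta> :: real assume "\<delta> > 0"
    then have "continuous_on {\<epsilon>..} (\<lambda>a. h \<delta> (of_real a - \<i> * of_real \<epsilon>))"
      using eps by (intro continuous_on_compose2[OF h_cont] continuous_intros) (auto simp: strip_def)
    then show "(\<lambda>a. indicator {\<epsilon>..} a *\<^sub>R h \<delta> (of_real a - \<i> * of_real \<epsilon>)) \<in> borel_measurable lborel"
      using borel_measurable_continuous_on_indicator[of "{\<epsilon>..}"] by simp
  next
    fix a
    show "((\<lambda>\<delta>. indicator {\<epsilon>..} a *\<^sub>R h \<delta> (of_real a - \<i> * of_real \<epsilon>))
        \<longlongrightarrow> indicator {\<epsilon>..} a *\<^sub>R h 0 (of_real a - \<i> * of_real \<epsilon>)) (at_right 0)"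
      using q_horizontal_nonzero[of a 0]
      by (cases "\<epsilon> \<le> a") (auto intro!: tendsto_intros h_tendsto)
  qed (rule bound)
  show ?bound if "\<delta> > 0"
    unfolding set_lebesgue_integral_def int(2)[symmetric]
    by (rule norm_integral_le) (use bound[OF that] int in auto)
qed

text \<open>On the real half-line the integrand may be singular at \<open>\<delta> = 0\<close>. The
  limit is therefore identified as the value at \<open>\<delta> = 0\<close> of the integral over the
  shifted contour, where \<open>q 0\<close> has no zero.\<close>

lemma integral_limit_bound:
  obtains K where "((\<lambda>\<delta>. LINT l:{0..}|lborel. h \<delta> (of_real l)) \<longlongrightarrow> K) (at_right 0)"
    and "\<And>\<delta>. \<delta> > 0 \<Longrightarrow> norm (LINT l:{0..}|lborel. h \<delta> (of_real l))
      \<le> 3 * pi / c\<^sup>2 * A / \<epsilon>^3 * (1 + r) powr (- (1 / 2 + real n))"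
proof -
  define I where "I \<delta> = (1 - \<i>) * (LINT a:{0..\<epsilon>}|lborel. h \<delta> (of_real a * (1 - \<i>)))
      + (LINT a:{\<epsilon>..}|lborel. h \<delta> (of_real a - \<i> * of_real \<epsilon>))" for \<delta>
  have shift: "(LINT l:{0..}|lborel. h \<delta> (of_real l)) = I \<delta>" if "\<delta> > 0" for \<delta>
    unfolding I_def
    by (rule h_decay[OF that], rule contour_shift) (use eps h_cont h_hol that in auto)
  have "(I \<longlongrightarrow> I 0) (at_right 0)"
    unfolding I_def by (intro tendsto_intros diag_part horizontal_part)
  then have "((\<lambda>\<delta>. LINT l:{0..}|lborel. h \<delta> (of_real l)) \<longlongrightarrow> I 0) (at_right 0)"
    by (rule Lim_transform_eventually)
       (auto simp: eventually_at_right_less shift intro: eventually_mono[OF eventually_at_right_less])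
  moreover have "norm (LINT l:{0..}|lborel. h \<delta> (of_real l))
      \<le> 3 * pi / c\<^sup>2 * A / \<epsilon>^3 * (1 + r) powr (- (1 / 2 + real n))" if "\<delta> > 0" for \<delta>
  proof -
    define R where "R = (1 + r) powr (- (1 / 2 + real n))"
    have c2: "0 < c\<^sup>2" using c_pos by simp
    have s2: "norm (1 - \<i>) \<le> 2"
      using norm_triangle_ineq4[of 1 \<i>] by simp
    have d: "A / (2 * c\<^sup>2 * \<epsilon>^3 * (1 + r)^(n + 1)) * (pi / (1 / sqrt (1 + r))) = pi / (2 * c\<^sup>2) * A / \<epsilon>^3 * R"
    proof -
      have "R = (1 + r) powr (1 / 2) * (1 + r) powr (- real (n + 1))"
        unfolding R_def by (simp flip: powr_add)
      also have "\<dots> = sqrt (1 + r) / (1 + r)^(n + 1)"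
        using r by (simp add: powr_half_sqrt powr_minus_divide powr_realpow[symmetric] del: of_nat_Suc power_Suc)
      finally show ?thesis by simp
    qed
    \<comment> \<open>The horizontal bound always has the power \<open>-3 / 2\<close>; for
      \<open>n = 0\<close> it is thus the diagonal that determines the rate.\<close>
    have R: "(1 + r) powr (- 3 / 2) \<le> R"
      unfolding R_def using r n by (intro powr_mono) auto
    have R0: "0 \<le> R" by (simp add: R_def)
    have h: "A / 2 * (1 + r) powr (- 3 / 2) * (2 / \<epsilon>^3 * (pi / c) + 1 / (c * \<epsilon>)\<^sup>2 * (pi / \<epsilon>))
        \<le> A / 2 * R * (2 / \<epsilon>^3 * (pi / c\<^sup>2) + 1 / (c * \<epsilon>)\<^sup>2 * (pi / \<epsilon>))"
    proof -
      have "c\<^sup>2 \<le> c" using eps c_pos by (simp add: power2_eq_square mult_le_cancel_left1)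
      then have "pi / c \<le> pi / c\<^sup>2" using c2 c_pos by (intro divide_left_mono mult_pos_pos) auto
      then show ?thesis
        using A_nonneg R R0 eps c_pos by (intro mult_mono add_mono) auto
    qed
    have "norm (I \<delta>) \<le> 2 * (pi / (2 * c\<^sup>2) * A / \<epsilon>^3 * R)
        + A / 2 * R * (2 / \<epsilon>^3 * (pi / c\<^sup>2) + 1 / (c * \<epsilon>)\<^sup>2 * (pi / \<epsilon>))"
      unfolding I_def
    proof (intro norm_triangle_le add_mono)
      show "norm ((1 - \<i>) * (LINT a:{0..\<epsilon>}|lborel. h \<delta> (of_real a * (1 - \<i>))))
          \<le> 2 * (pi / (2 * c\<^sup>2) * A / \<epsilon>^3 * R)"
        unfolding norm_mult using diag_part(2)[OF that] s2 unfolding d by (intro mult_mono) auto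
    qed (rule order_trans[OF horizontal_part(2)[OF that] h])
    \<comment> \<open>The diagonal contributes \<open>1\<close>, the two terms of the horizontal
      bound \<open>1\<close> and \<open>1 / 2\<close>.\<close>
    also have "\<dots> = (5 / 2) * (pi / c\<^sup>2 * A / \<epsilon>^3 * R)"
      using eps c_pos by (simp add: field_simps power2_eq_square power3_eq_cube)
    also have "\<dots> \<le> 3 * (pi / c\<^sup>2 * A / \<epsilon>^3 * R)"
      using A_nonneg eps by (intro mult_right_mono) (auto simp: R_def)
    finally show ?thesis
      using shift[OF that] by (simp add: R_def)
  qed
  ultimately show thesis by (rule that)
qed

end

section \<open>The dressing coefficients\<close>

text \<open>An equivalence, so that existence and uniqueness of the dressing coefficients come out
  together.\<close>

lemma cramer_two:
  fixes m11 :: "'a::field"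
  assumes "m11 * m22 - m12 * m21 \<noteq> 0"
  shows "m11 * x + m12 * y = r1 \<and> m21 * x + m22 * y = r2 \<longleftrightarrow>
    x = (r1 * m22 - r2 * m12) / (m11 * m22 - m12 * m21) \<and>
    y = (m11 * r2 - m21 * r1) / (m11 * m22 - m12 * m21)" (is "?L \<longleftrightarrow> ?R")
proof -
  define D where "D = m11 * m22 - m12 * m21"
  have "D \<noteq> 0" using assms by (simp add: D_def)
  have "?R \<longleftrightarrow> D * x = r1 * m22 - r2 * m12 \<and> D * y = m11 * r2 - m21 * r1"
    using \<open>D \<noteq> 0\<close> by (auto simp: D_def[symmetric] field_simps)
  moreover have "?L"
    if e: "D * x = r1 * m22 - r2 * m12" "D * y = m11 * r2 - m21 * r1"
  proof
    have "D * (m11 * x + m12 * y) = m11 * (D * x) + m12 * (D * y)"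
      by (simp add: algebra_simps)
    also have "\<dots> = D * r1"
      unfolding e by (simp add: D_def algebra_simps)
    finally show "m11 * x + m12 * y = r1" using \<open>D \<noteq> 0\<close> by simp
    have "D * (m21 * x + m22 * y) = m21 * (D * x) + m22 * (D * y)"
      by (simp add: algebra_simps)
    also have "\<dots> = D * r2"
      unfolding e by (simp add: D_def algebra_simps)
    finally show "m21 * x + m22 * y = r2" using \<open>D \<noteq> 0\<close> by simp
  qed
  moreover have "D * x = r1 * m22 - r2 * m12 \<and> D * y = m11 * r2 - m21 * r1" if ?L
  proof -
    have "r1 = m11 * x + m12 * y" "r2 = m21 * x + m22 * y" using that by auto
    then show ?thesis by (simp add: D_def algebra_simps)
  qed
  ultimately show ?thesis by blast
qed

text \<open>For imaginary \<open>w\<close> the conjugate is \<open>- w\<close>, so the two equations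
  prescribe \<open>b0 + b1 * w\<close> and \<open>b0 - b1 * w\<close>, and half their sum and
  difference solve them. With \<open>E = exp (2 * \<rho> k * x)\<close> the combinations of
  \<open>E\<close> and \<open>E'\<close> are hyperbolic sine and cosine.\<close>

lemma dressing_pair_iff:
  fixes g g' E E' w a0 a1 b0 b1 :: complex
  assumes "g * g' = 1" "E * E' = 1"
  shows "(w\<^sup>2 + a1 * w + a0) * E = g' * (b1 * w + b0) \<and>
      b1 * (- w) + b0 = - g * ((- w)\<^sup>2 + a1 * (- w) + a0) * E' \<longleftrightarrow>
    b0 = g * ((E - E') / 2 * (a0 + w\<^sup>2) + (E + E') / 2 * (a1 * w)) \<and>
    b1 * w = g * ((E + E') / 2 * (a0 + w\<^sup>2) + (E - E') / 2 * (a1 * w))" (is "?L1 \<and> ?L2 \<longleftrightarrow> ?R1 \<and> ?R2")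
proof -
  define p where "p = g * E * (a0 + w\<^sup>2 + a1 * w)"
  define m where "m = - g * E' * (a0 + w\<^sup>2 - a1 * w)"
  have "?L1 \<longleftrightarrow> b1 * w + b0 = p"
  proof
    assume ?L1
    then have "g * ((w\<^sup>2 + a1 * w + a0) * E) = (g * g') * (b1 * w + b0)" by (simp add: mult_ac)
    then show "b1 * w + b0 = p" using assms by (simp add: p_def algebra_simps)
  next
    assume "b1 * w + b0 = p"
    then have "g' * (b1 * w + b0) = (g * g') * E * (a0 + w\<^sup>2 + a1 * w)" by (simp add: p_def)
    then show ?L1 using assms by (simp add: algebra_simps)
  qed
  moreover have "?L2 \<longleftrightarrow> b0 - b1 * w = m"
    by (simp add: m_def algebra_simps)
  moreover have "g * ((E - E') / 2 * (a0 + w\<^sup>2) + (E + E') / 2 * (a1 * w)) = (p + m) / 2"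
    by (simp add: p_def m_def field_simps)
  moreover have "g * ((E + E') / 2 * (a0 + w\<^sup>2) + (E - E') / 2 * (a1 * w)) = (p - m) / 2"
    by (simp add: p_def m_def field_simps)
  moreover have "u + b0 = p \<and> b0 - u = m \<longleftrightarrow> b0 = (p + m) / 2 \<and> u = (p - m) / 2" for u
  proof
    assume "u + b0 = p \<and> b0 - u = m"
    then have "p = u + b0" "m = b0 - u" by auto
    then show "b0 = (p + m) / 2 \<and> u = (p - m) / 2" by simp
  next
    assume a: "b0 = (p + m) / 2 \<and> u = (p - m) / 2"
    show "u + b0 = p \<and> b0 - u = m"
      unfolding a[THEN conjunct1] a[THEN conjunct2]
      by (simp flip: add_divide_distrib diff_divide_distrib)
  qed
  ultimately show ?thesis by (simp only:)
qed

lemma cosh_complex_of_real_sq: "(complex_of_real (cosh t))\<^sup>2 = (complex_of_real (sinh t))\<^sup>2 + 1"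
  by (metis cosh_square_eq of_real_1 of_real_add of_real_power)

lemma gph_nonzero: "gph \<theta> k \<noteq> 0"
  by (simp add: gph_def)

text \<open>Twice the cosine is the sum of the two quotients of the phases. The identity lets
  \<open>gph \<theta> 1 * gph \<theta> 2\<close> be factored out of the determinant of the dressing
  system.\<close>

lemma gph_cos: "2 * gph \<theta> 1 * gph \<theta> 2 * complex_of_real (cos (\<theta> 1 - \<theta> 2)) = (gph \<theta> 1)\<^sup>2 + (gph \<theta> 2)\<^sup>2"
proof -
  have "2 * complex_of_real (cos (\<theta> 1 - \<theta> 2)) = exp (\<i> * of_real (\<theta> 1 - \<theta> 2)) + exp (- (\<i> * of_real (\<theta> 1 - \<theta> 2)))"
    by (simp add: cos_exp_eq flip: cos_of_real)
  then have "2 * gph \<theta> 1 * gph \<theta> 2 * complex_of_real (cos (\<theta> 1 - \<theta> 2))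
      = gph \<theta> 1 * gph \<theta> 2 * (exp (\<i> * of_real (\<theta> 1 - \<theta> 2)) + exp (- (\<i> * of_real (\<theta> 1 - \<theta> 2))))"
    by simp
  also have "\<dots> = (gph \<theta> 1)\<^sup>2 + (gph \<theta> 2)\<^sup>2"
    unfolding gph_def by (simp add: power2_eq_square algebra_simps flip: exp_add)
  finally show ?thesis .
qed

text \<open>The determinant of the system for \<open>a0\<close> and \<open>\<i> * a1\<close> that is
  left after eliminating \<open>b0\<close> and \<open>b1\<close>, divided by
  \<open>gph \<theta> 1 * gph \<theta> 2\<close>, which makes it real.\<close>

definition dressing_det :: "(nat \<Rightarrow> real) \<Rightarrow> (nat \<Rightarrow> real) \<Rightarrow> real \<Rightarrow> real" where
  "dressing_det \<rho> \<theta> x =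
     ((\<rho> 1)\<^sup>2 + (\<rho> 2)\<^sup>2) * cosh (2 * \<rho> 1 * x) * cosh (2 * \<rho> 2 * x)
     - 2 * \<rho> 1 * \<rho> 2 * sinh (2 * \<rho> 1 * x) * sinh (2 * \<rho> 2 * x)
     - 2 * \<rho> 1 * \<rho> 2 * cos (\<theta> 1 - \<theta> 2)"

text \<open>This and \<open>coeff1\<close> are the Cramer quotients for \<open>a0\<close> and
  \<open>a1\<close>, with the common phase factor cancelled.\<close>

definition coeff0 :: "(nat \<Rightarrow> real) \<Rightarrow> (nat \<Rightarrow> real) \<Rightarrow> real \<Rightarrow> complex" where
  "coeff0 \<rho> \<theta> x = of_real (\<rho> 1 * \<rho> 2) *
     (of_real (2 * \<rho> 1 * \<rho> 2 * cosh (2 * \<rho> 1 * x) * cosh (2 * \<rho> 2 * x)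
        - ((\<rho> 1)\<^sup>2 + (\<rho> 2)\<^sup>2) * sinh (2 * \<rho> 1 * x) * sinh (2 * \<rho> 2 * x))
      - of_real ((\<rho> 1)\<^sup>2) * gph \<theta> 1 / gph \<theta> 2 - of_real ((\<rho> 2)\<^sup>2) * gph \<theta> 2 / gph \<theta> 1)
     / of_real (dressing_det \<rho> \<theta> x)"

definition coeff1 :: "(nat \<Rightarrow> real) \<Rightarrow> (nat \<Rightarrow> real) \<Rightarrow> real \<Rightarrow> complex" where
  "coeff1 \<rho> \<theta> x = - \<i> * of_real (((\<rho> 2)\<^sup>2 - (\<rho> 1)\<^sup>2) *
     (\<rho> 2 * cosh (2 * \<rho> 1 * x) * sinh (2 * \<rho> 2 * x) - \<rho> 1 * sinh (2 * \<rho> 1 * x) * cosh (2 * \<rho> 2 * x)))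
     / of_real (dressing_det \<rho> \<theta> x)"

lemma abs_sinh_le_cosh: "\<bar>sinh (t::real)\<bar> \<le> cosh t"
  by (metis cosh_real_pos less_imp_le cosh_real_abs cosh_real_strict_mono sinh_real_abs sinh_less_cosh_real)

text \<open>Since \<open>cos (\<theta> 1 - \<theta> 2) \<le> 1 \<le> cosh (2 * \<rho> 1 * x - 2 *
  \<rho> 2 * x)\<close>, the two subtracted terms together are at most
  \<open>2 * \<rho> 1 * \<rho> 2\<close> times the product of the hyperbolic cosines. The bound
  retains that product because the numerators of the coefficients grow at the same rate.\<close>

lemma dressing_det_ge:
  assumes "0 < \<rho> 1" "\<rho> 1 < \<rho> 2"
  shows "(\<rho> 2 - \<rho> 1)\<^sup>2 * (cosh (2 * \<rho> 1 * x) * cosh (2 * \<rho> 2 * x)) \<le> dressing_det \<rho> \<theta> x"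
proof -
  have "1 \<le> cosh (2 * \<rho> 1 * x - 2 * \<rho> 2 * x)"
    by (rule cosh_real_ge_1)
  then have "1 \<le> cosh (2 * \<rho> 1 * x) * cosh (2 * \<rho> 2 * x) - sinh (2 * \<rho> 1 * x) * sinh (2 * \<rho> 2 * x)"
    by (simp add: cosh_diff)
  then have "cos (\<theta> 1 - \<theta> 2)
      \<le> cosh (2 * \<rho> 1 * x) * cosh (2 * \<rho> 2 * x) - sinh (2 * \<rho> 1 * x) * sinh (2 * \<rho> 2 * x)"
    using cos_le_one order_trans by blast
  then have "2 * \<rho> 1 * \<rho> 2 * cos (\<theta> 1 - \<theta> 2) \<le> 2 * \<rho> 1 * \<rho> 2 *
      (cosh (2 * \<rho> 1 * x) * cosh (2 * \<rho> 2 * x) - sinh (2 * \<rho> 1 * x) * sinh (2 * \<rho> 2 * x))"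
    using assms by (intro mult_left_mono) auto
  then show ?thesis
    unfolding dressing_det_def by (simp add: power2_eq_square algebra_simps)
qed

lemma dressing_det_pos:
  assumes "0 < \<rho> 1" "\<rho> 1 < \<rho> 2"
  shows "0 < dressing_det \<rho> \<theta> x"
proof -
  have "0 < (\<rho> 2 - \<rho> 1)\<^sup>2 * (cosh (2 * \<rho> 1 * x) * cosh (2 * \<rho> 2 * x))"
    using assms by (intro mult_pos_pos) auto
  then show ?thesis using dressing_det_ge[OF assms, of x \<theta>] by linarith
qed

lemma dressing_system_iff:
  assumes "0 < \<rho> 1" "\<rho> 1 < \<rho> 2"
  defines "w \<equiv> \<lambda>k. \<i> * complex_of_real (\<rho> k)"
    and "S \<equiv> \<lambda>k x. complex_of_real (sinh (2 * \<rho> k * x))"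
    and "C \<equiv> \<lambda>k x. complex_of_real (cosh (2 * \<rho> k * x))"
  shows "dressing_system \<rho> \<theta> x (a0, a1, b0, b1) \<longleftrightarrow>
    (\<forall>k\<in>{1, 2}. b0 = gph \<theta> k * (S k x * (a0 + (w k)\<^sup>2) + C k x * (a1 * w k)) \<and>
       b1 * w k = gph \<theta> k * (C k x * (a0 + (w k)\<^sup>2) + S k x * (a1 * w k)))"
proof -
  have cnj_w: "cnj (w k) = - w k" and ev: "ev \<rho> k = w k" for k
    by (simp_all add: ev_def w_def)
  have g: "gph \<theta> k * cnj (gph \<theta> k) = 1" for k
    by (simp add: gph_def exp_cnj flip: exp_add)
  define E where "E k = complex_of_real (exp (2 * \<rho> k * x))" for k
  define E' where "E' k = complex_of_real (exp (- (2 * \<rho> k * x)))" for k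
  have e: "exp (- 2 * \<i> * w k * complex_of_real x) = E k" for k
    unfolding E_def exp_of_real[symmetric] by (rule arg_cong[where f = exp]) (simp add: w_def)
  have e': "exp (- 2 * \<i> * (- w k) * complex_of_real x) = E' k" for k
    unfolding E'_def exp_of_real[symmetric] by (rule arg_cong[where f = exp]) (simp add: w_def)
  have EE: "E k * E' k = 1" for k
    by (simp add: E_def E'_def exp_minus flip: of_real_mult)
  have S: "S k x = (E k - E' k) / 2" and C: "C k x = (E k + E' k) / 2" for k
    by (simp_all add: S_def C_def E_def E'_def sinh_field_def cosh_field_def)
  show ?thesis
    unfolding dressing_system_def prod.case ev cnj_w e e' S C dressing_pair_iff[OF g EE] ..
qed

text \<open>The system is equivalent to explicit formulas for all four unknowns, which resolves the
  definite description. \<open>b0\<close> and \<open>b1\<close> stay existential because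
  \<open>a_fun\<close> only reads the first two components.\<close>

lemma dressing_coeffs_eq:
  assumes "0 < \<rho> 1" "\<rho> 1 < \<rho> 2"
  shows "\<exists>b0 b1. dressing_coeffs \<rho> \<theta> x = (coeff0 \<rho> \<theta> x, coeff1 \<rho> \<theta> x, b0, b1)"
proof -
  define w where "w k = \<i> * complex_of_real (\<rho> k)" for k
  define S where "S k = complex_of_real (sinh (2 * \<rho> k * x))" for k
  define C where "C k = complex_of_real (cosh (2 * \<rho> k * x))" for k
  define g where "g = gph \<theta>"
  define p where "p k = complex_of_real (\<rho> k)" for k
  define D where "D = complex_of_real (dressing_det \<rho> \<theta> x)"
  define co where "co = complex_of_real (cos (\<theta> 1 - \<theta> 2))"
  have CS: "C k * C k = S k * S k + 1" for k
    using cosh_complex_of_real_sq by (simp add: C_def S_def power2_eq_square)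
  have g0: "g k \<noteq> 0" for k by (simp add: g_def gph_nonzero)
  have p0: "p 1 \<noteq> 0" "p 2 \<noteq> 0" using assms by (auto simp: p_def)
  have D0: "D \<noteq> 0" using dressing_det_pos[OF assms, of \<theta> x] by (simp add: D_def)
  have D: "D = ((p 1)\<^sup>2 + (p 2)\<^sup>2) * C 1 * C 2 - 2 * p 1 * p 2 * S 1 * S 2 - 2 * p 1 * p 2 * co"
    by (simp add: D_def dressing_det_def p_def C_def S_def co_def)
  have co: "2 * g 1 * g 2 * co = g 1 * g 1 + g 2 * g 2"
    using gph_cos[of \<theta>] by (simp add: g_def co_def power2_eq_square)
  \<comment> \<open>Eliminating \<open>b0\<close> and \<open>b1\<close> leaves a two by two system for \<open>a0\<close> and \<open>\<i> * a1\<close>.\<close>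
  define m11 where "m11 = g 1 * S 1 - g 2 * S 2"
  define m12 where "m12 = g 1 * p 1 * C 1 - g 2 * p 2 * C 2"
  define m21 where "m21 = p 2 * g 1 * C 1 - p 1 * g 2 * C 2"
  \<comment> \<open>The second equation equates the two expressions for \<open>b1\<close>,
    multiplied by \<open>p 1\<close> to clear the denominator; the coefficient of
    \<open>\<i> * a1\<close> is then this multiple of \<open>m11\<close>.\<close>
  define m22 where "m22 = p 1 * p 2 * m11"
  define r1 where "r1 = g 1 * S 1 * (p 1)\<^sup>2 - g 2 * S 2 * (p 2)\<^sup>2"
  define r2 where "r2 = p 2 * (p 1)\<^sup>2 * g 1 * C 1 - p 1 * (p 2)\<^sup>2 * g 2 * C 2"
  \<comment> \<open>The squares of \<open>g 1\<close> and \<open>g 2\<close> are multiplied by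
    differences of the form \<open>S k * S k - C k * C k\<close>, that is \<open>-1\<close>, and
    \<open>co\<close> turns what is left of them into a multiple of
    \<open>g 1 * g 2\<close>.\<close>
  have det: "m11 * m22 - m12 * m21 = g 1 * g 2 * D"
    unfolding m11_def m12_def m21_def m22_def D using CS[of 1] CS[of 2] co by algebra
  have n0: "r1 * m22 - r2 * m12 = p 1 * p 2 * (g 1 * g 2 *
      (2 * p 1 * p 2 * C 1 * C 2 - ((p 1)\<^sup>2 + (p 2)\<^sup>2) * S 1 * S 2)
      - (p 1)\<^sup>2 * (g 1)\<^sup>2 - (p 2)\<^sup>2 * (g 2)\<^sup>2)"
    unfolding m11_def m12_def m22_def r1_def r2_def using CS[of 1] CS[of 2] by algebra
  have n1: "m11 * r2 - m21 * r1 = g 1 * g 2 * (((p 2)\<^sup>2 - (p 1)\<^sup>2) * (p 2 * C 1 * S 2 - p 1 * S 1 * C 2))"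
    unfolding m11_def m21_def r1_def r2_def by algebra
  have c0: "coeff0 \<rho> \<theta> x = (r1 * m22 - r2 * m12) / (m11 * m22 - m12 * m21)"
    unfolding n0 det using g0 D0
    by (simp add: coeff0_def D_def[symmetric] g_def[symmetric] p_def C_def S_def field_simps power2_eq_square)
  have c1: "\<i> * coeff1 \<rho> \<theta> x = (m11 * r2 - m21 * r1) / (m11 * m22 - m12 * m21)"
    unfolding n1 det using g0 D0
    by (simp add: coeff1_def D_def[symmetric] p_def C_def S_def)
  define b0 where "b0 a0 a1 = g 1 * (S 1 * (a0 + (w 1)\<^sup>2) + C 1 * (a1 * w 1))" for a0 a1
  define b1 where "b1 a0 a1 = g 1 * (C 1 * (a0 + (w 1)\<^sup>2) + S 1 * (a1 * w 1)) / w 1" for a0 a1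
  have w: "w k = \<i> * p k" for k by (simp add: w_def p_def)
  have w0: "w 1 \<noteq> 0" "w 2 \<noteq> 0" using p0 by (auto simp: w)
  have sys: "dressing_system \<rho> \<theta> x (a0, a1, c0, c1) \<longleftrightarrow>
      c0 = b0 a0 a1 \<and> c1 = b1 a0 a1 \<and> a0 = coeff0 \<rho> \<theta> x \<and> a1 = coeff1 \<rho> \<theta> x" for a0 a1 c0 c1
  proof -
    have iff: "dressing_system \<rho> \<theta> x (a0, a1, c0, c1) \<longleftrightarrow>
      (\<forall>k\<in>{1, 2}. c0 = g k * (S k * (a0 + (w k)\<^sup>2) + C k * (a1 * w k)) \<and>
         c1 * w k = g k * (C k * (a0 + (w k)\<^sup>2) + S k * (a1 * w k)))"
      unfolding w_def S_def C_def g_def by (rule dressing_system_iff[OF assms])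
    have quot: "c1 * w 1 = Z \<longleftrightarrow> c1 = Z / w 1" for Z
      using w0 by (simp add: nonzero_eq_divide_eq)
    have "dressing_system \<rho> \<theta> x (a0, a1, c0, c1) \<longleftrightarrow>
      (c0 = b0 a0 a1 \<and> c1 = b1 a0 a1) \<and>
      b0 a0 a1 = g 2 * (S 2 * (a0 + (w 2)\<^sup>2) + C 2 * (a1 * w 2)) \<and>
      b1 a0 a1 * w 2 = g 2 * (C 2 * (a0 + (w 2)\<^sup>2) + S 2 * (a1 * w 2))"
      unfolding iff b0_def b1_def by (auto simp: quot simp del: One_nat_def)
    also have "b0 a0 a1 = g 2 * (S 2 * (a0 + (w 2)\<^sup>2) + C 2 * (a1 * w 2)) \<longleftrightarrow>
        m11 * a0 + m12 * (\<i> * a1) = r1"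
      unfolding b0_def m11_def m12_def r1_def w by (auto simp: algebra_simps power_mult_distrib)
    also have "b1 a0 a1 * w 2 = g 2 * (C 2 * (a0 + (w 2)\<^sup>2) + S 2 * (a1 * w 2)) \<longleftrightarrow>
        m21 * a0 + m22 * (\<i> * a1) = r2"
    proof -
      have "b1 a0 a1 * w 2 = g 1 * (C 1 * (a0 + (w 1)\<^sup>2) + S 1 * (a1 * w 1)) * p 2 / p 1"
        by (simp add: b1_def w)
      moreover have "Z / p 1 = Y \<longleftrightarrow> Z = Y * p 1" for Y Z
        using p0 by (simp add: nonzero_divide_eq_eq)
      ultimately show ?thesis
        unfolding m11_def m21_def m22_def r2_def w
        by (simp only:) (auto simp: algebra_simps power2_eq_square)
    qed
    also have "m11 * a0 + m12 * (\<i> * a1) = r1 \<and> m21 * a0 + m22 * (\<i> * a1) = r2 \<longleftrightarrow>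
        a0 = coeff0 \<rho> \<theta> x \<and> a1 = coeff1 \<rho> \<theta> x"
      using cramer_two[of m11 m22 m12 m21 a0 "\<i> * a1" r1 r2] det g0 D0
      unfolding c0[symmetric] c1[symmetric] by simp
    finally show ?thesis by simp
  qed
  have "dressing_coeffs \<rho> \<theta> x = (coeff0 \<rho> \<theta> x, coeff1 \<rho> \<theta> x,
      b0 (coeff0 \<rho> \<theta> x) (coeff1 \<rho> \<theta> x), b1 (coeff0 \<rho> \<theta> x) (coeff1 \<rho> \<theta> x))"
    unfolding dressing_coeffs_def
  proof (rule the_equality)
    fix c assume "dressing_system \<rho> \<theta> x c"
    then show "c = (coeff0 \<rho> \<theta> x, coeff1 \<rho> \<theta> x,
      b0 (coeff0 \<rho> \<theta> x) (coeff1 \<rho> \<theta> x), b1 (coeff0 \<rho> \<theta> x) (coeff1 \<rho> \<theta> x))"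
      by (cases c) (auto simp: sys)
  qed (simp add: sys)
  then show ?thesis by blast
qed

lemma continuous_on_coeff:
  assumes "0 < \<rho> 1" "\<rho> 1 < \<rho> 2"
  shows "continuous_on UNIV (coeff0 \<rho> \<theta>)" "continuous_on UNIV (coeff1 \<rho> \<theta>)"
proof -
  have "complex_of_real (dressing_det \<rho> \<theta> x) \<noteq> 0" for x
    using dressing_det_pos[OF assms, of \<theta> x] by simp
  moreover have "continuous_on UNIV (dressing_det \<rho> \<theta>)"
    unfolding dressing_det_def by (intro continuous_intros)
  ultimately show "continuous_on UNIV (coeff0 \<rho> \<theta>)" "continuous_on UNIV (coeff1 \<rho> \<theta>)"
    unfolding coeff0_def coeff1_def using gph_nonzero
    by (auto intro!: continuous_intros)
qed

text \<open>The numerators grow at most like the product of the two hyperbolic cosines, and the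
  determinant at least like it.\<close>

lemma norm_coeff_le:
  assumes "0 < \<rho> 1" "\<rho> 1 < \<rho> 2"
  obtains M where "M \<ge> 0" "\<And>x. norm (coeff0 \<rho> \<theta> x) \<le> M" "\<And>x. norm (coeff1 \<rho> \<theta> x) \<le> M"
proof
  define k where "k = (\<rho> 2 - \<rho> 1)\<^sup>2"
  \<comment> \<open>\<open>M0\<close> and \<open>M1\<close> arise by replacing each
    \<open>sinh\<close> by \<open>cosh\<close> and adding absolute values. The terms constant in
    \<open>x\<close> are absorbed through \<open>1 \<le> C1 * C2\<close>, which doubles the squares
    in \<open>M0\<close>.\<close>
  define M0 where "M0 = \<rho> 1 * \<rho> 2 * (2 * \<rho> 1 * \<rho> 2 + 2 * (\<rho> 1)\<^sup>2 + 2 * (\<rho> 2)\<^sup>2)"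
  define M1 where "M1 = ((\<rho> 2)\<^sup>2 - (\<rho> 1)\<^sup>2) * (\<rho> 2 + \<rho> 1)"
  have k: "0 < k" using assms by (simp add: k_def)
  have sq: "(\<rho> 1)\<^sup>2 < (\<rho> 2)\<^sup>2" using assms by (intro power_strict_mono) auto
  have M: "0 \<le> M0" "0 \<le> M1" using assms sq by (auto simp: M0_def M1_def)
  then show "0 \<le> (M0 + M1) / k" using k by simp
  fix x
  define C1 where "C1 = cosh (2 * \<rho> 1 * x)"
  define C2 where "C2 = cosh (2 * \<rho> 2 * x)"
  define S1 where "S1 = sinh (2 * \<rho> 1 * x)"
  define S2 where "S2 = sinh (2 * \<rho> 2 * x)"
  have C: "1 \<le> C1" "1 \<le> C2" "\<bar>S1\<bar> \<le> C1" "\<bar>S2\<bar> \<le> C2"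
    by (auto simp: C1_def C2_def S1_def S2_def cosh_real_ge_1 abs_sinh_le_cosh)
  have CC: "1 \<le> C1 * C2" using C mult_mono[of 1 C1 1 C2] by simp
  have SS: "\<bar>S1 * S2\<bar> \<le> C1 * C2" "\<bar>C1 * S2\<bar> \<le> C1 * C2" "\<bar>S1 * C2\<bar> \<le> C1 * C2"
    unfolding abs_mult using C by (auto intro!: mult_mono)
  have det: "k * (C1 * C2) \<le> dressing_det \<rho> \<theta> x"
    unfolding k_def C1_def C2_def by (rule dressing_det_ge[OF assms])
  have quot: "m / dressing_det \<rho> \<theta> x \<le> (M0 + M1) / k"
    if "m \<le> M' * (C1 * C2)" "M' \<in> {M0, M1}" for m M'
  proof -
    have "m \<le> (M0 + M1) * (C1 * C2)"
      by (rule order_trans[OF that(1)], rule mult_right_mono) (use that M CC in auto)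
    then have "m / dressing_det \<rho> \<theta> x \<le> ((M0 + M1) * (C1 * C2)) / (k * (C1 * C2))"
      using det k CC M by (intro frac_le) auto
    also have "\<dots> = (M0 + M1) / k"
      using CC by (intro mult_divide_mult_cancel_right) linarith
    finally show ?thesis .
  qed
  have d: "norm (complex_of_real (dressing_det \<rho> \<theta> x)) = dressing_det \<rho> \<theta> x"
    using dressing_det_pos[OF assms, of \<theta> x] by simp
  have g1: "norm (gph \<theta> j) = 1" for j by (simp add: gph_def)
  let ?N = "complex_of_real (2 * \<rho> 1 * \<rho> 2 * C1 * C2 - ((\<rho> 1)\<^sup>2 + (\<rho> 2)\<^sup>2) * S1 * S2)
      - of_real ((\<rho> 1)\<^sup>2) * gph \<theta> 1 / gph \<theta> 2 - of_real ((\<rho> 2)\<^sup>2) * gph \<theta> 2 / gph \<theta> 1"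
  have "norm ?N \<le> \<bar>2 * \<rho> 1 * \<rho> 2 * C1 * C2 - ((\<rho> 1)\<^sup>2 + (\<rho> 2)\<^sup>2) * S1 * S2\<bar> + (\<rho> 1)\<^sup>2 + (\<rho> 2)\<^sup>2"
    by (rule order_trans[OF norm_triangle_ineq4 add_mono[OF order_trans[OF norm_triangle_ineq4]]])
       (simp_all add: norm_mult norm_divide g1 del: of_real_mult of_real_diff of_real_add of_real_power)
  also have "\<bar>2 * \<rho> 1 * \<rho> 2 * C1 * C2 - ((\<rho> 1)\<^sup>2 + (\<rho> 2)\<^sup>2) * S1 * S2\<bar>
      \<le> 2 * \<rho> 1 * \<rho> 2 * (C1 * C2) + ((\<rho> 1)\<^sup>2 + (\<rho> 2)\<^sup>2) * (C1 * C2)"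
  proof -
    have "\<bar>2 * \<rho> 1 * \<rho> 2 * (C1 * C2)\<bar> = 2 * \<rho> 1 * \<rho> 2 * (C1 * C2)"
      using assms CC by simp
    moreover have "\<bar>((\<rho> 1)\<^sup>2 + (\<rho> 2)\<^sup>2) * (S1 * S2)\<bar> \<le> ((\<rho> 1)\<^sup>2 + (\<rho> 2)\<^sup>2) * (C1 * C2)"
      unfolding abs_mult[of "_ + _"] using SS(1) by (intro mult_mono) auto
    ultimately show ?thesis by (simp only: mult.assoc)
  qed
  also have "2 * \<rho> 1 * \<rho> 2 * (C1 * C2) + ((\<rho> 1)\<^sup>2 + (\<rho> 2)\<^sup>2) * (C1 * C2) + (\<rho> 1)\<^sup>2 + (\<rho> 2)\<^sup>2
      \<le> (2 * \<rho> 1 * \<rho> 2 + 2 * (\<rho> 1)\<^sup>2 + 2 * (\<rho> 2)\<^sup>2) * (C1 * C2)"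
    using mult_left_mono[OF CC, of "(\<rho> 1)\<^sup>2 + (\<rho> 2)\<^sup>2"] by (simp add: algebra_simps)
  finally have N: "norm ?N \<le> (2 * \<rho> 1 * \<rho> 2 + 2 * (\<rho> 1)\<^sup>2 + 2 * (\<rho> 2)\<^sup>2) * (C1 * C2)" by simp
  have r12: "norm (complex_of_real (\<rho> 1 * \<rho> 2)) = \<rho> 1 * \<rho> 2"
    using assms by (simp only: norm_of_real) simp
  have "norm (coeff0 \<rho> \<theta> x) = \<rho> 1 * \<rho> 2 * norm ?N / dressing_det \<rho> \<theta> x"
    unfolding coeff0_def C1_def[symmetric] C2_def[symmetric] S1_def[symmetric] S2_def[symmetric]
      norm_mult norm_divide d r12 ..
  also have "\<dots> \<le> (M0 + M1) / k"
    using mult_left_mono[OF N, of "\<rho> 1 * \<rho> 2"] assms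
    by (intro quot[of _ M0]) (auto simp: M0_def mult.assoc)
  finally show "norm (coeff0 \<rho> \<theta> x) \<le> (M0 + M1) / k" .
  have "\<bar>\<rho> 2 * (C1 * S2) - \<rho> 1 * (S1 * C2)\<bar> \<le> \<rho> 2 * (C1 * C2) + \<rho> 1 * (C1 * C2)"
    using SS assms by (intro order_trans[OF abs_triangle_ineq4] add_mono) (auto simp: abs_mult intro!: mult_mono)
  then have "((\<rho> 2)\<^sup>2 - (\<rho> 1)\<^sup>2) * \<bar>\<rho> 2 * (C1 * S2) - \<rho> 1 * (S1 * C2)\<bar> \<le> M1 * (C1 * C2)"
    using mult_left_mono[of _ _ "(\<rho> 2)\<^sup>2 - (\<rho> 1)\<^sup>2"] sq
    by (fastforce simp: M1_def algebra_simps)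
  moreover have r: "norm (complex_of_real (((\<rho> 2)\<^sup>2 - (\<rho> 1)\<^sup>2) * (\<rho> 2 * C1 * S2 - \<rho> 1 * S1 * C2)))
      = ((\<rho> 2)\<^sup>2 - (\<rho> 1)\<^sup>2) * \<bar>\<rho> 2 * (C1 * S2) - \<rho> 1 * (S1 * C2)\<bar>"
    using sq by (simp only: norm_of_real abs_mult mult.assoc)
  moreover have "norm (coeff1 \<rho> \<theta> x)
      = ((\<rho> 2)\<^sup>2 - (\<rho> 1)\<^sup>2) * \<bar>\<rho> 2 * (C1 * S2) - \<rho> 1 * (S1 * C2)\<bar> / dressing_det \<rho> \<theta> x"
    unfolding coeff1_def C1_def[symmetric] C2_def[symmetric] S1_def[symmetric] S2_def[symmetric]
      norm_divide d norm_mult[of "- \<i>"] r by simp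
  ultimately show "norm (coeff1 \<rho> \<theta> x) \<le> (M0 + M1) / k"
    using quot[of _ M1] by auto
qed

section \<open>The spectral kernel\<close>

lemma japanese_ge: "1 \<le> japanese x" "\<bar>x\<bar> \<le> japanese x" "0 < japanese x"
proof -
  show 1: "1 \<le> japanese x" "\<bar>x\<bar> \<le> japanese x"
    by (auto simp: japanese_def real_le_rsqrt)
  show "0 < japanese x" using 1(1) by linarith
qed

text \<open>The numerator of \<open>Psi\<close>, continued to a complex spectral parameter;
  \<open>s\<close> is the sign that distinguishes the parities.\<close>

definition dressed :: "complex \<Rightarrow> complex \<Rightarrow> complex \<Rightarrow> real \<Rightarrow> complex \<Rightarrow> complex" where
  "dressed s c0 c1 x z = (z\<^sup>2 + c1 * z + c0) * exp (- 2 * \<i> * z * of_real x)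
     + s * ((z\<^sup>2 - c1 * z + c0) * exp (2 * \<i> * z * of_real x))"

text \<open>\<open>Psi\<close> has a square root in its denominator. In the product with a conjugate
  the two roots combine to this polynomial, whose zeros have distance at least
  \<open>\<rho> 1\<close> from the real axis; hence the product is what is continued.\<close>

definition spectral_weight :: "(nat \<Rightarrow> real) \<Rightarrow> complex \<Rightarrow> complex" where
  "spectral_weight \<rho> z = 2 * of_real pi * (z\<^sup>2 + of_real ((\<rho> 1)\<^sup>2)) * (z\<^sup>2 + of_real ((\<rho> 2)\<^sup>2))"

definition parity_sign :: "parity \<Rightarrow> complex" where
  "parity_sign \<alpha> = (case \<alpha> of Ev \<Rightarrow> 1 | Od \<Rightarrow> - 1)"

text \<open>The order to which one factor \<open>dressed\<close> is guaranteed to vanish at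
  \<open>0\<close>. The kernel has two such factors, whence the power
  \<open>(a\<^sup>2)^n\<close>.\<close>

definition vanishing_order :: "parity \<Rightarrow> nat" where
  "vanishing_order \<alpha> = (case \<alpha> of Ev \<Rightarrow> 0 | Od \<Rightarrow> 1)"

text \<open>The holomorphic extension of \<open>\<lambda>l. Psi \<rho> \<theta> \<alpha> x l * cnj (Psi \<rho> \<theta> \<alpha> y l)\<close> arises for
  \<open>d0 = cnj (coeff0 \<rho> \<theta> y)\<close>, \<open>d1 = cnj (coeff1 \<rho> \<theta> y)\<close> and \<open>- y\<close> in place of \<open>y\<close>. With the coefficients
  as free parameters, the family is closed under complex conjugation.\<close>

definition spectral_kernel ::
  "(nat \<Rightarrow> real) \<Rightarrow> parity \<Rightarrow> complex \<Rightarrow> complex \<Rightarrow> real \<Rightarrow> complex \<Rightarrow> complex \<Rightarrow> real \<Rightarrow> complex \<Rightarrow> complex" where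
  "spectral_kernel \<rho> \<alpha> c0 c1 x d0 d1 y z =
     dressed (parity_sign \<alpha>) c0 c1 x z * dressed (parity_sign \<alpha>) d0 d1 y z / spectral_weight \<rho> z"

lemma norm_parity_sign: "norm (parity_sign \<alpha>) = 1"
  and cnj_parity_sign: "cnj (parity_sign \<alpha>) = parity_sign \<alpha>"
  by (cases \<alpha>; simp add: parity_sign_def)+

lemma cnj_dressed:
  "cnj (dressed s c0 c1 x z) = dressed (cnj s) (cnj c0) (cnj c1) (- x) (cnj z)"
  by (simp add: dressed_def exp_cnj)

lemma cnj_spectral_weight: "cnj (spectral_weight \<rho> z) = spectral_weight \<rho> (cnj z)"
  by (simp add: spectral_weight_def)

text \<open>Two such factors grow like \<open>(1 + (norm z)\<^sup>2)\<^sup>2\<close>, which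
  \<open>spectral_weight\<close> compensates. The last assumption keeps the exponentials below
  \<open>exp 2\<close>.\<close>

lemma norm_dressed_le:
  assumes "norm s = 1" "norm c0 \<le> M" "norm c1 \<le> M" "\<bar>Im z * x\<bar> \<le> 1"
  shows "norm (dressed s c0 c1 x z) \<le> 2 * exp 2 * (1 + 2 * M) * (1 + (norm z)\<^sup>2)"
proof -
  have M: "0 \<le> M" using assms norm_ge_zero order_trans by blast
  have z1: "norm z \<le> 1 + (norm z)\<^sup>2"
    using sum_squares_bound[of "norm z" 1] zero_le_power2[of "norm z"] norm_ge_zero[of z]
    unfolding power_one mult_1_right by linarith
  have poly: "norm (z\<^sup>2 + c * z + c0) \<le> (1 + 2 * M) * (1 + (norm z)\<^sup>2)" if "norm c \<le> M" for c
  proof -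
    have "norm (z\<^sup>2 + c * z + c0) \<le> norm (z\<^sup>2) + norm (c * z) + norm c0"
      by (intro norm_triangle_le add_mono norm_triangle_ineq order_refl)
    also have "\<dots> \<le> (norm z)\<^sup>2 + M * (1 + (norm z)\<^sup>2) + M"
      using that assms z1 M by (intro add_mono) (auto simp: norm_mult norm_power intro!: mult_mono)
    also have "\<dots> \<le> (1 + 2 * M) * (1 + (norm z)\<^sup>2)"
      using M by (simp add: algebra_simps)
    finally show ?thesis .
  qed
  have e: "norm (exp (- 2 * \<i> * z * of_real x)) \<le> exp 2" "norm (exp (2 * \<i> * z * of_real x)) \<le> exp 2"
    using assms(4) by auto
  have p1: "norm (z\<^sup>2 + c1 * z + c0) \<le> (1 + 2 * M) * (1 + (norm z)\<^sup>2)"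
    by (rule poly[OF assms(3)])
  have p2: "norm (z\<^sup>2 - c1 * z + c0) \<le> (1 + 2 * M) * (1 + (norm z)\<^sup>2)"
    using poly[of "- c1"] assms(3) by simp
  have "norm (dressed s c0 c1 x z) \<le> (1 + 2 * M) * (1 + (norm z)\<^sup>2) * exp 2 + (1 + 2 * M) * (1 + (norm z)\<^sup>2) * exp 2"
    unfolding dressed_def
    by (intro norm_triangle_le add_mono) (use M assms(1) in \<open>auto simp only: norm_mult mult_1 intro!: mult_mono e p1 p2\<close>, auto)
  then show ?thesis by (simp add: algebra_simps)
qed

text \<open>The real part alone is at least \<open>(Re z)\<^sup>2 + \<rho>\<^sup>2 / 2\<close>. The
  constant is at most \<open>1\<close>, and its product with \<open>1 + \<rho>\<^sup>2\<close> is
  \<open>\<rho>\<^sup>2 / 2\<close>.\<close>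

lemma norm_sq_plus_ge:
  fixes \<rho> :: real
  assumes "\<bar>Im z\<bar> \<le> \<rho> / 2"
  shows "\<rho>\<^sup>2 / (2 * (1 + \<rho>\<^sup>2)) * (1 + (norm z)\<^sup>2) \<le> norm (z\<^sup>2 + of_real (\<rho>\<^sup>2))"
proof -
  have b: "(Im z)\<^sup>2 \<le> \<rho>\<^sup>2 / 4"
    using power_mono[OF assms, of 2] by (simp add: power_divide)
  then have b': "(Im z)\<^sup>2 \<le> \<rho>\<^sup>2" using zero_le_power2[of \<rho>] by linarith
  define k where "k = \<rho>\<^sup>2 / (2 * (1 + \<rho>\<^sup>2))"
  have p: "0 < 1 + \<rho>\<^sup>2" by (simp add: add_pos_nonneg)
  have k: "0 \<le> k" "k \<le> 1" "k * (1 + \<rho>\<^sup>2) = \<rho>\<^sup>2 / 2"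
    using p by (auto simp: k_def divide_simps)
  have "k * (1 + (norm z)\<^sup>2) = k * (Re z)\<^sup>2 + k * (1 + (Im z)\<^sup>2)"
    by (simp add: cmod_power2 algebra_simps)
  also have "\<dots> \<le> 1 * (Re z)\<^sup>2 + k * (1 + \<rho>\<^sup>2)"
    using k b' by (intro add_mono mult_right_mono mult_left_mono) auto
  also have "\<dots> \<le> (Re z)\<^sup>2 - (Im z)\<^sup>2 + \<rho>\<^sup>2"
    using k(3) b zero_le_power2[of \<rho>] by linarith
  also have "\<dots> \<le> norm (z\<^sup>2 + of_real (\<rho>\<^sup>2))"
    using abs_Re_le_cmod[of "z\<^sup>2 + of_real (\<rho>\<^sup>2)"] by (simp add: power2_eq_square)
  finally show ?thesis by (simp add: k_def)
qed

lemma spectral_weight_ge: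
  assumes "0 < \<rho> 1" "\<rho> 1 < \<rho> 2"
  obtains k where "0 < k" "\<And>z. \<bar>Im z\<bar> \<le> \<rho> 1 / 2 \<Longrightarrow> k * (1 + (norm z)\<^sup>2)\<^sup>2 \<le> norm (spectral_weight \<rho> z)"
proof
  define k1 where "k1 = (\<rho> 1)\<^sup>2 / (2 * (1 + (\<rho> 1)\<^sup>2))"
  define k2 where "k2 = (\<rho> 2)\<^sup>2 / (2 * (1 + (\<rho> 2)\<^sup>2))"
  have k: "0 < k1" "0 < k2"
    using assms by (auto simp: k1_def k2_def intro!: divide_pos_pos add_pos_nonneg)
  then show "0 < 2 * pi * (k1 * k2)" by simp
  fix z assume z: "\<bar>Im z\<bar> \<le> \<rho> 1 / 2"
  have "(k1 * (1 + (norm z)\<^sup>2)) * (k2 * (1 + (norm z)\<^sup>2))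
      \<le> norm (z\<^sup>2 + of_real ((\<rho> 1)\<^sup>2)) * norm (z\<^sup>2 + of_real ((\<rho> 2)\<^sup>2))"
    unfolding k1_def k2_def using z assms by (intro mult_mono norm_sq_plus_ge) auto
  then have "2 * pi * ((k1 * (1 + (norm z)\<^sup>2)) * (k2 * (1 + (norm z)\<^sup>2)))
      \<le> 2 * pi * (norm (z\<^sup>2 + of_real ((\<rho> 1)\<^sup>2)) * norm (z\<^sup>2 + of_real ((\<rho> 2)\<^sup>2)))"
    by (intro mult_left_mono) auto
  also have "\<dots> = norm (spectral_weight \<rho> z)"
    by (simp add: spectral_weight_def norm_mult)
  finally show "2 * pi * (k1 * k2) * (1 + (norm z)\<^sup>2)\<^sup>2 \<le> norm (spectral_weight \<rho> z)"
    by (simp only: power2_eq_square mult_ac)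
qed

lemma norm_spectral_kernel_le:
  assumes "0 < \<rho> 1" "\<rho> 1 < \<rho> 2"
  obtains A where "0 < A" "\<And>\<alpha> c0 c1 x d0 d1 y z.
    norm c0 \<le> M \<Longrightarrow> norm c1 \<le> M \<Longrightarrow> norm d0 \<le> M \<Longrightarrow> norm d1 \<le> M \<Longrightarrow>
    \<bar>Im z\<bar> \<le> \<rho> 1 / 2 \<Longrightarrow> \<bar>Im z * x\<bar> \<le> 1 \<Longrightarrow> \<bar>Im z * y\<bar> \<le> 1 \<Longrightarrow>
    norm (spectral_kernel \<rho> \<alpha> c0 c1 x d0 d1 y z) \<le> A"
proof -
  obtain k where k: "0 < k" "\<And>z. \<bar>Im z\<bar> \<le> \<rho> 1 / 2 \<Longrightarrow> k * (1 + (norm z)\<^sup>2)\<^sup>2 \<le> norm (spectral_weight \<rho> z)"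
    using spectral_weight_ge[OF assms] by blast
  define B where "B = 2 * exp 2 * (1 + 2 * M)"
  show thesis
  proof (rule that)
    \<comment> \<open>The summand \<open>1\<close> gives strict positivity without any information
      on \<open>M\<close>.\<close>
    show "0 < B\<^sup>2 / k + 1" using k by (simp add: add_nonneg_pos)
    fix \<alpha> and c0 c1 d0 d1 z :: complex and x y :: real
    assume a: "norm c0 \<le> M" "norm c1 \<le> M" "norm d0 \<le> M" "norm d1 \<le> M"
      "\<bar>Im z\<bar> \<le> \<rho> 1 / 2" "\<bar>Im z * x\<bar> \<le> 1" "\<bar>Im z * y\<bar> \<le> 1"
    have M: "0 \<le> M" using a(1) norm_ge_zero order_trans by blast
    have w: "0 < 1 + (norm z)\<^sup>2" by (simp add: add_pos_nonneg)
    have "norm (spectral_kernel \<rho> \<alpha> c0 c1 x d0 d1 y z)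
        \<le> (B * (1 + (norm z)\<^sup>2)) * (B * (1 + (norm z)\<^sup>2)) / (k * (1 + (norm z)\<^sup>2)\<^sup>2)"
      unfolding spectral_kernel_def norm_divide norm_mult B_def using k w M a
      by (intro frac_le mult_mono norm_dressed_le norm_parity_sign) auto
    also have "\<dots> = B\<^sup>2 / k"
      using w by (simp add: power2_eq_square)
    finally show "norm (spectral_kernel \<rho> \<alpha> c0 c1 x d0 d1 y z) \<le> B\<^sup>2 / k + 1" by simp
  qed
qed

lemma norm_exp_diff_le: "norm (exp (- u) - exp u) \<le> 2 * norm u * exp (norm (u::complex))"
proof -
  have "norm (exp v - exp 0) \<le> exp (norm u) * norm (v - 0)" if "norm v \<le> norm u" for v :: complex
  proof (rule field_differentiable_bound[where S = "cball 0 (norm u)"])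
    show "(exp has_field_derivative exp z) (at z within cball 0 (norm u))" for z :: complex
      by (auto intro!: derivative_eq_intros)
    show "norm (exp z) \<le> exp (norm u)" if "z \<in> cball 0 (norm u)" for z :: complex
      using that norm_exp[of z] by (auto intro: order_trans)
  qed (use that in auto)
  from this[of u] this[of "- u"]
  have "norm (exp (- u) - exp 0) + norm (exp u - exp 0) \<le> 2 * norm u * exp (norm u)"
    by (simp add: algebra_simps)
  then show ?thesis
    using norm_triangle_ineq4[of "exp (- u) - exp 0" "exp u - exp 0"] by simp
qed

text \<open>Sorting by the coefficients, \<open>z\<^sup>2 + c0\<close> meets a difference of
  exponentials, which is of order \<open>norm z * \<bar>x\<bar>\<close>, and the sum of exponentials
  comes with the explicit factor \<open>c1 * z\<close>. Both terms vanish at \<open>z = 0\<close>,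
  at the cost of one factor \<open>japanese x\<close>.\<close>

lemma norm_odd_dressed_le:
  assumes "norm c0 \<le> M" "norm c1 \<le> M" "norm z \<le> 2" "norm z * \<bar>x\<bar> \<le> 2"
  shows "norm (dressed (- 1) c0 c1 x z) \<le> exp 4 * (16 + 6 * M) * norm z * japanese x"
proof -
  have M: "0 \<le> M" using assms norm_ge_zero order_trans by blast
  have J: "\<bar>x\<bar> \<le> japanese x" "1 \<le> japanese x"
    by (auto simp: japanese_def real_le_rsqrt)
  define u where "u = 2 * \<i> * z * of_real x"
  have u: "norm u = 2 * (norm z * \<bar>x\<bar>)" by (simp add: u_def norm_mult)
  have eu: "exp (norm u) \<le> exp 4" using assms(4) u by (subst exp_le_cancel_iff) linarith
  have "dressed (- 1) c0 c1 x z = (z\<^sup>2 + c0) * (exp (- u) - exp u) + c1 * z * (exp (- u) + exp u)"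
    by (simp add: dressed_def u_def algebra_simps)
  also have "norm \<dots> \<le> (4 + M) * (4 * (norm z * \<bar>x\<bar>) * exp 4) + M * norm z * (2 * exp 4)"
  proof (intro norm_triangle_le add_mono)
    have "(norm z)\<^sup>2 \<le> 4" using power_mono[OF assms(3), of 2] by simp
    then have "norm (z\<^sup>2 + c0) \<le> 4 + M"
      using assms by (intro norm_triangle_le add_mono) (auto simp: norm_power)
    moreover have "norm (exp (- u) - exp u) \<le> 4 * (norm z * \<bar>x\<bar>) * exp 4"
      by (rule order_trans[OF norm_exp_diff_le]) (use eu u in \<open>auto intro!: mult_mono\<close>)
    ultimately show "norm ((z\<^sup>2 + c0) * (exp (- u) - exp u)) \<le> (4 + M) * (4 * (norm z * \<bar>x\<bar>) * exp 4)"
      unfolding norm_mult using M by (intro mult_mono) auto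
    have "norm (exp (- u) + exp u) \<le> 2 * exp 4"
      using norm_triangle_ineq[of "exp (- u)" "exp u"] norm_exp[of u] norm_exp[of "- u"] eu
      unfolding norm_minus_cancel by linarith
    then show "norm (c1 * z * (exp (- u) + exp u)) \<le> M * norm z * (2 * exp 4)"
      unfolding norm_mult using M assms by (intro mult_mono) auto
  qed
  also have "\<dots> \<le> (4 + M) * (4 * (norm z * japanese x) * exp 4) + M * norm z * (2 * exp 4) * japanese x"
    using M J mult_left_mono[OF J(2), of "M * norm z * (2 * exp 4)"]
    by (intro add_mono mult_left_mono mult_right_mono) auto
  also have "\<dots> = exp 4 * (16 + 6 * M) * norm z * japanese x"
    by (simp add: algebra_simps)
  finally show ?thesis .
qed

lemma norm_odd_spectral_kernel_le:
  assumes "0 < \<rho> 1" "\<rho> 1 < \<rho> 2"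
  obtains A where "0 < A" "\<And>c0 c1 x d0 d1 y z.
    norm c0 \<le> M \<Longrightarrow> norm c1 \<le> M \<Longrightarrow> norm d0 \<le> M \<Longrightarrow> norm d1 \<le> M \<Longrightarrow>
    \<bar>Im z\<bar> \<le> \<rho> 1 / 2 \<Longrightarrow> norm z \<le> 2 \<Longrightarrow> norm z * \<bar>x\<bar> \<le> 2 \<Longrightarrow> norm z * \<bar>y\<bar> \<le> 2 \<Longrightarrow>
    norm (spectral_kernel \<rho> Od c0 c1 x d0 d1 y z) \<le> A * (norm z)\<^sup>2 * japanese x * japanese y"
proof -
  obtain k where k: "0 < k" "\<And>z. \<bar>Im z\<bar> \<le> \<rho> 1 / 2 \<Longrightarrow> k * (1 + (norm z)\<^sup>2)\<^sup>2 \<le> norm (spectral_weight \<rho> z)"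
    using spectral_weight_ge[OF assms] by blast
  define B where "B = exp 4 * (16 + 6 * M)"
  show thesis
  proof (rule that)
    show "0 < B\<^sup>2 / k + 1" using k by (simp add: add_nonneg_pos)
    fix c0 c1 d0 d1 z :: complex and x y :: real
    assume a: "norm c0 \<le> M" "norm c1 \<le> M" "norm d0 \<le> M" "norm d1 \<le> M"
      "\<bar>Im z\<bar> \<le> \<rho> 1 / 2" "norm z \<le> 2" "norm z * \<bar>x\<bar> \<le> 2" "norm z * \<bar>y\<bar> \<le> 2"
    have M: "0 \<le> M" using a(1) norm_ge_zero order_trans by blast
    have J: "0 \<le> japanese t" for t by (simp add: japanese_def)
    have "1 \<le> (1 + (norm z)\<^sup>2)\<^sup>2" by (simp add: one_le_power)
    then have kw: "k \<le> norm (spectral_weight \<rho> z)"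
      using k(1) k(2)[OF a(5)] mult_left_mono[of 1 "(1 + (norm z)\<^sup>2)\<^sup>2" k] by linarith
    have "norm (spectral_kernel \<rho> Od c0 c1 x d0 d1 y z)
        \<le> (B * norm z * japanese x) * (B * norm z * japanese y) / k"
      unfolding spectral_kernel_def norm_divide norm_mult B_def parity_sign_def parity.case
      using k kw M a J by (intro frac_le mult_mono norm_odd_dressed_le) auto
    also have "\<dots> = B\<^sup>2 / k * ((norm z)\<^sup>2 * japanese x * japanese y)"
      by (simp add: power2_eq_square)
    also have "\<dots> \<le> (B\<^sup>2 / k + 1) * ((norm z)\<^sup>2 * japanese x * japanese y)"
      using J by (intro mult_right_mono) auto
    finally show "norm (spectral_kernel \<rho> Od c0 c1 x d0 d1 y z)
        \<le> (B\<^sup>2 / k + 1) * (norm z)\<^sup>2 * japanese x * japanese y"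
      by (simp add: mult_ac)
  qed
qed

lemma spectral_kernel_continuous:
  assumes "0 < \<rho> 1" "\<rho> 1 < \<rho> 2" "\<epsilon> \<le> \<rho> 1 / 2"
  shows "continuous_on (strip \<epsilon>) (spectral_kernel \<rho> \<alpha> c0 c1 x d0 d1 y)"
    and "z \<in> strip \<epsilon> \<Longrightarrow> spectral_kernel \<rho> \<alpha> c0 c1 x d0 d1 y field_differentiable at z"
proof -
  obtain k where k: "0 < k" "\<And>z. \<bar>Im z\<bar> \<le> \<rho> 1 / 2 \<Longrightarrow> k * (1 + (norm z)\<^sup>2)\<^sup>2 \<le> norm (spectral_weight \<rho> z)"
    using spectral_weight_ge[OF assms(1,2)] by blast
  have diff: "spectral_kernel \<rho> \<alpha> c0 c1 x d0 d1 y field_differentiable at z" if "z \<in> strip \<epsilon>" for z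
  proof -
    have "\<bar>Im z\<bar> \<le> \<rho> 1 / 2" using that assms by (auto simp: strip_def)
    moreover have "0 < 1 + (norm z)\<^sup>2" by (simp add: add_pos_nonneg)
    ultimately have "0 < norm (spectral_weight \<rho> z)"
      using k(1) less_le_trans[OF mult_pos_pos[OF k(1) zero_less_power] k(2)[of z]] by blast
    then have "spectral_weight \<rho> z \<noteq> 0" by simp
    moreover have "spectral_weight \<rho> field_differentiable at z"
      unfolding spectral_weight_def
      by (rule holomorphic_on_imp_differentiable_at[of _ UNIV]) (auto intro!: holomorphic_intros)
    moreover have "dressed s e0 e1 v field_differentiable at z" for s e0 e1 v
      unfolding dressed_def
      by (rule holomorphic_on_imp_differentiable_at[of _ UNIV]) (auto intro!: holomorphic_intros)
    ultimately show ?thesis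
      unfolding spectral_kernel_def by (intro derivative_intros) auto
  qed
  then show "z \<in> strip \<epsilon> \<Longrightarrow> spectral_kernel \<rho> \<alpha> c0 c1 x d0 d1 y field_differentiable at z" .
  show "continuous_on (strip \<epsilon>) (spectral_kernel \<rho> \<alpha> c0 c1 x d0 d1 y)"
    by (intro continuous_at_imp_continuous_on ballI field_differentiable_imp_continuous_at diff)
qed

section \<open>Uniform bounds for the kernel of the resolvent evolution\<close>

definition resolvent_factor :: "real \<Rightarrow> real \<Rightarrow> real \<Rightarrow> real \<Rightarrow> real \<Rightarrow> complex" where
  "resolvent_factor \<kappa> r \<mu> \<delta> l = exp (- 2 * \<i> * complex_of_real (l\<^sup>2) * complex_of_real (\<kappa> * r))
     / (2 * complex_of_real (l\<^sup>2) - 2 * complex_of_real \<mu> - 2 * \<i> * complex_of_real \<kappa> * complex_of_real \<delta>)"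

text \<open>Each pair \<open>x\<close>, \<open>y\<close> has its own \<open>\<epsilon>\<close>,
  while \<open>c\<close> and \<open>A\<close> are common to all pairs. The coefficients enter only
  through \<open>M\<close>, so the constant also covers the conjugated data that
  \<open>\<kappa> = - 1\<close> leads to.\<close>

proposition kernel_limit_bound:
  assumes "0 < \<rho> 1" "\<rho> 1 < \<rho> 2" "0 < \<mu>min" "0 \<le> M"
  obtains C where "0 < C" "\<And>\<alpha> c0 c1 d0 d1 x y \<mu> r \<kappa>.
    norm c0 \<le> M \<Longrightarrow> norm c1 \<le> M \<Longrightarrow> norm d0 \<le> M \<Longrightarrow> norm d1 \<le> M \<Longrightarrow>
    \<mu>min \<le> \<bar>\<mu>\<bar> \<Longrightarrow> 0 \<le> r \<Longrightarrow> \<kappa> \<in> {1, -1} \<Longrightarrow>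
    \<exists>K. ((\<lambda>\<delta>. LINT l:{0..}|lborel. resolvent_factor \<kappa> r \<mu> \<delta> l
            * spectral_kernel \<rho> \<alpha> c0 c1 x d0 d1 y (of_real l)) \<longlongrightarrow> K) (at_right 0) \<and>
      (\<forall>\<delta>>0. norm (LINT l:{0..}|lborel. resolvent_factor \<kappa> r \<mu> \<delta> l
            * spectral_kernel \<rho> \<alpha> c0 c1 x d0 d1 y (of_real l))
         \<le> C * (1 + r) powr (- (1 / 2 + real (vanishing_order \<alpha>))) * japanese x ^ 3 * japanese y ^ 3)"
proof -
  obtain A0 where A0: "0 < A0" "\<And>\<alpha> c0 c1 x d0 d1 y z.
    norm c0 \<le> M \<Longrightarrow> norm c1 \<le> M \<Longrightarrow> norm d0 \<le> M \<Longrightarrow> norm d1 \<le> M \<Longrightarrow>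
    \<bar>Im z\<bar> \<le> \<rho> 1 / 2 \<Longrightarrow> \<bar>Im z * x\<bar> \<le> 1 \<Longrightarrow> \<bar>Im z * y\<bar> \<le> 1 \<Longrightarrow>
    norm (spectral_kernel \<rho> \<alpha> c0 c1 x d0 d1 y z) \<le> A0"
    using norm_spectral_kernel_le[OF assms(1,2), of M] by blast
  obtain A1 where A1: "0 < A1" "\<And>c0 c1 x d0 d1 y z.
    norm c0 \<le> M \<Longrightarrow> norm c1 \<le> M \<Longrightarrow> norm d0 \<le> M \<Longrightarrow> norm d1 \<le> M \<Longrightarrow>
    \<bar>Im z\<bar> \<le> \<rho> 1 / 2 \<Longrightarrow> norm z \<le> 2 \<Longrightarrow> norm z * \<bar>x\<bar> \<le> 2 \<Longrightarrow> norm z * \<bar>y\<bar> \<le> 2 \<Longrightarrow>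
    norm (spectral_kernel \<rho> Od c0 c1 x d0 d1 y z) \<le> A1 * (norm z)\<^sup>2 * japanese x * japanese y"
    using norm_odd_spectral_kernel_le[OF assms(1,2), of M] by blast
  \<comment> \<open>The three terms ensure that powers of \<open>c\<close> and
    \<open>\<epsilon>\<close> are at most \<open>1\<close>, that the strip avoids the zeros of
    \<open>spectral_weight\<close>, and that \<open>4 * c\<^sup>2 \<le> \<mu>min\<close>.\<close>
  define c where "c = min 1 (min (\<rho> 1 / 2) (sqrt \<mu>min / 2))"
  have c: "0 < c" "c \<le> 1" "c \<le> \<rho> 1 / 2" using assms by (auto simp: c_def)
  have c_mu: "4 * c\<^sup>2 \<le> \<mu>min"
  proof -
    have "(2 * c)\<^sup>2 \<le> (sqrt \<mu>min)\<^sup>2" by (rule power_mono) (use c in \<open>auto simp: c_def\<close>)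
    then show ?thesis using assms by (simp add: power_mult_distrib)
  qed
  \<comment> \<open>\<open>A0\<close> bounds the kernel on the strip; \<open>2 * A1\<close> is for
    the odd kernel on the diagonal, where \<open>(norm z)\<^sup>2 = 2 * a\<^sup>2\<close>.\<close>
  define A where "A = A0 + 2 * A1"
  define C where "C = 3 * pi / c\<^sup>2 * A / c ^ 3"
  have C: "0 < C" using A0 A1 c by (simp add: C_def A_def)
  have plus: "\<exists>K. ((\<lambda>\<delta>. LINT l:{0..}|lborel. resolvent_factor 1 r \<mu> \<delta> l
            * spectral_kernel \<rho> \<alpha> c0 c1 x d0 d1 y (of_real l)) \<longlongrightarrow> K) (at_right 0) \<and>
      (\<forall>\<delta>>0. norm (LINT l:{0..}|lborel. resolvent_factor 1 r \<mu> \<delta> l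
            * spectral_kernel \<rho> \<alpha> c0 c1 x d0 d1 y (of_real l))
         \<le> C * (1 + r) powr (- (1 / 2 + real (vanishing_order \<alpha>))) * japanese x ^ 3 * japanese y ^ 3)"
    if coeffs: "norm c0 \<le> M" "norm c1 \<le> M" "norm d0 \<le> M" "norm d1 \<le> M"
      and \<mu>: "\<mu>min \<le> \<bar>\<mu>\<bar>" and r: "0 \<le> r"
    for \<alpha> c0 c1 d0 d1 x y \<mu> r
  proof -
    let ?G = "spectral_kernel \<rho> \<alpha> c0 c1 x d0 d1 y"
    define \<epsilon> where "\<epsilon> = c / (japanese x * japanese y)"
    have J1: "1 \<le> japanese x * japanese y"
      using mult_mono[of 1 "japanese x" 1 "japanese y"] japanese_ge(1)[of x] japanese_ge(1)[of y] by simp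
    have eps: "0 < \<epsilon>" "\<epsilon> \<le> c"
      using c J1 by (auto simp: \<epsilon>_def field_simps)
    have eJ: "\<epsilon> * (japanese x * japanese y) = c"
      using japanese_ge(3)[of x] japanese_ge(3)[of y] by (simp add: \<epsilon>_def)
    have ex: "\<epsilon> * \<bar>x\<bar> \<le> 1" "\<epsilon> * \<bar>y\<bar> \<le> 1"
    proof -
      have "\<bar>x\<bar> \<le> japanese x * japanese y" "\<bar>y\<bar> \<le> japanese x * japanese y"
        using mult_mono[of "\<bar>x\<bar>" "japanese x" 1 "japanese y"] japanese_ge[of x]
          mult_mono[of 1 "japanese x" "\<bar>y\<bar>" "japanese y"] japanese_ge[of y] by auto
      then have "\<epsilon> * \<bar>x\<bar> \<le> c" "\<epsilon> * \<bar>y\<bar> \<le> c"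
        unfolding eJ[symmetric] using eps by (auto intro!: mult_left_mono)
      then show "\<epsilon> * \<bar>x\<bar> \<le> 1" "\<epsilon> * \<bar>y\<bar> \<le> 1" using c by auto
    qed
    have G_A0: "norm (?G z) \<le> A0" if "z \<in> strip \<epsilon>" for z
    proof (rule A0(2)[OF coeffs])
      have i: "\<bar>Im z\<bar> \<le> \<epsilon>" using that by (auto simp: strip_def)
      then show "\<bar>Im z\<bar> \<le> \<rho> 1 / 2" using eps c by linarith
      show "\<bar>Im z * x\<bar> \<le> 1" "\<bar>Im z * y\<bar> \<le> 1"
        using ex mult_right_mono[OF i, of "\<bar>x\<bar>"] mult_right_mono[OF i, of "\<bar>y\<bar>"]
        by (auto simp: abs_mult)
    qed
    interpret oscillatory_resolvent \<epsilon> c \<mu> r A "vanishing_order \<alpha>" ?G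
    proof
      show "continuous_on (strip \<epsilon>) ?G"
        using spectral_kernel_continuous(1)[OF assms(1,2)] eps c by auto
      show "?G field_differentiable at z" if "z \<in> interior (strip \<epsilon>)" for z
        by (rule spectral_kernel_continuous(2)[OF assms(1,2), where \<epsilon> = \<epsilon>])
           (use eps c that interior_subset in auto)
      show "norm (?G z) \<le> A" if "z \<in> strip \<epsilon>" for z
        using G_A0[OF that] A1(1) by (simp add: A_def)
      show "norm (?G (of_real a * (1 - \<i>))) \<le> A / \<epsilon>^3 * (a\<^sup>2) ^ vanishing_order \<alpha>"
        if a: "0 \<le> a" "a \<le> \<epsilon>" for a
      proof -
        let ?z = "of_real a * (1 - \<i>)"
        have e3: "0 < \<epsilon> ^ 3" "\<epsilon> ^ 3 \<le> 1" using eps c by (auto intro: power_le_one)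
        show ?thesis
        proof (cases \<alpha>)
          case Ev
          have "norm (?G ?z) \<le> A0" by (rule G_A0) (use a eps in \<open>simp add: strip_def\<close>)
          also have "\<dots> \<le> A" using A1 by (simp add: A_def)
          also have "\<dots> \<le> A / \<epsilon> ^ 3"
            using e3 A0(1) A1(1) mult_left_mono[OF e3(2), of A] by (simp add: A_def pos_le_divide_eq)
          finally show ?thesis by (simp add: Ev vanishing_order_def)
        next
          case Od
          have nz: "(norm ?z)\<^sup>2 = 2 * a\<^sup>2" by (simp add: cmod_power2)
          have "norm ?z \<le> 2 * a"
            by (rule power2_le_imp_le) (use nz a in \<open>auto simp: power_mult_distrib\<close>)
          then have nz': "norm ?z \<le> 2 * \<epsilon>" using a by linarith
          have "norm (spectral_kernel \<rho> Od c0 c1 x d0 d1 y ?z)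
              \<le> A1 * (norm ?z)\<^sup>2 * japanese x * japanese y"
          proof (rule A1(2)[OF coeffs])
            show "\<bar>Im ?z\<bar> \<le> \<rho> 1 / 2" using a eps c by simp
            show "norm ?z \<le> 2" using nz' eps c by linarith
            show "norm ?z * \<bar>x\<bar> \<le> 2" "norm ?z * \<bar>y\<bar> \<le> 2"
              using mult_right_mono[OF nz', of "\<bar>x\<bar>"] mult_right_mono[OF nz', of "\<bar>y\<bar>"] ex by auto
          qed
          also have "\<dots> = 2 * A1 * a\<^sup>2 * (japanese x * japanese y)"
            unfolding nz by simp
          \<comment> \<open>The odd bound costs
            \<open>japanese x * japanese y = c / \<epsilon>\<close>, well within the three powers
            that the horizontal part spends anyway.\<close>
          also have "\<dots> \<le> A * a\<^sup>2 * (1 / \<epsilon> ^ 3)"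
          proof (intro mult_mono mult_right_mono)
            have "\<epsilon> ^ 3 \<le> \<epsilon> ^ 1" using eps c by (intro power_decreasing) auto
            then have "1 / \<epsilon> \<le> 1 / \<epsilon> ^ 3" using eps e3 by (intro divide_left_mono) auto
            moreover have "japanese x * japanese y \<le> 1 / \<epsilon>"
              using eJ eps c by (simp add: field_simps)
            ultimately show "japanese x * japanese y \<le> 1 / \<epsilon> ^ 3" by linarith
          qed (use A0 A1 J1 in \<open>auto simp: A_def\<close>)
          finally show ?thesis by (simp add: Od vanishing_order_def)
        qed
      qed
      show "vanishing_order \<alpha> \<le> 1" by (cases \<alpha>) (auto simp: vanishing_order_def)
    qed (use eps c c_mu \<mu> r in auto)
    have h: "h \<delta> (of_real l) = resolvent_factor 1 r \<mu> \<delta> l * ?G (of_real l)" for \<delta> l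
      by (simp add: h_def q_def resolvent_factor_def algebra_simps)
    have const: "3 * pi / c\<^sup>2 * A / \<epsilon> ^ 3 * R = C * R * japanese x ^ 3 * japanese y ^ 3" for R
    proof -
      have "\<epsilon> ^ 3 = c ^ 3 / (japanese x ^ 3 * japanese y ^ 3)"
        by (simp add: \<epsilon>_def power_divide power_mult_distrib)
      then show ?thesis by (simp add: C_def)
    qed
    show ?thesis
      by (rule integral_limit_bound) (use h const in auto)
  qed
  show thesis
  proof (rule that[OF C])
    fix \<alpha> and c0 c1 d0 d1 :: complex and x y \<mu> r \<kappa> :: real
    assume coeffs: "norm c0 \<le> M" "norm c1 \<le> M" "norm d0 \<le> M" "norm d1 \<le> M"
      and \<mu>: "\<mu>min \<le> \<bar>\<mu>\<bar>" and r: "0 \<le> r" and \<kappa>: "\<kappa> \<in> {1, -1}"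
    show "\<exists>K. ((\<lambda>\<delta>. LINT l:{0..}|lborel. resolvent_factor \<kappa> r \<mu> \<delta> l
            * spectral_kernel \<rho> \<alpha> c0 c1 x d0 d1 y (of_real l)) \<longlongrightarrow> K) (at_right 0) \<and>
      (\<forall>\<delta>>0. norm (LINT l:{0..}|lborel. resolvent_factor \<kappa> r \<mu> \<delta> l
            * spectral_kernel \<rho> \<alpha> c0 c1 x d0 d1 y (of_real l))
         \<le> C * (1 + r) powr (- (1 / 2 + real (vanishing_order \<alpha>))) * japanese x ^ 3 * japanese y ^ 3)"
    proof (cases "\<kappa> = 1")
      case True
      then show ?thesis using plus[OF coeffs \<mu> r] by simp
    next
      case False
      then have \<kappa>: "\<kappa> = - 1" using \<kappa> by auto
      \<comment> \<open>Conjugation reverses \<open>\<kappa>\<close>, conjugates the coefficients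
        and flips the signs of \<open>x\<close> and \<open>y\<close>; neither the norms nor
        \<open>japanese\<close> notice.\<close>
      let ?I = "\<lambda>\<delta>. LINT l:{0..}|lborel. resolvent_factor 1 r \<mu> \<delta> l
            * spectral_kernel \<rho> \<alpha> (cnj c0) (cnj c1) (- x) (cnj d0) (cnj d1) (- y) (of_real l)"
      have "resolvent_factor (- 1) r \<mu> \<delta> l * spectral_kernel \<rho> \<alpha> c0 c1 x d0 d1 y (of_real l)
         = cnj (resolvent_factor 1 r \<mu> \<delta> l
            * spectral_kernel \<rho> \<alpha> (cnj c0) (cnj c1) (- x) (cnj d0) (cnj d1) (- y) (of_real l))" for \<delta> l
        by (simp add: spectral_kernel_def cnj_dressed cnj_spectral_weight cnj_parity_sign
            resolvent_factor_def exp_cnj)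
      then have I: "(LINT l:{0..}|lborel. resolvent_factor \<kappa> r \<mu> \<delta> l
            * spectral_kernel \<rho> \<alpha> c0 c1 x d0 d1 y (of_real l)) = cnj (?I \<delta>)" for \<delta>
        unfolding \<kappa> set_lebesgue_integral_def Bochner_Integration.integral_cnj[symmetric] by simp
      obtain K where K: "(?I \<longlongrightarrow> K) (at_right 0)" "\<And>\<delta>. \<delta> > 0 \<Longrightarrow> norm (?I \<delta>)
         \<le> C * (1 + r) powr (- (1 / 2 + real (vanishing_order \<alpha>))) * japanese (- x) ^ 3 * japanese (- y) ^ 3"
        using plus[of "cnj c0" "cnj c1" "cnj d0" "cnj d1" \<mu> r \<alpha> "- x" "- y"] coeffs \<mu> r by auto
      show ?thesis
        unfolding I using tendsto_cnj[OF K(1)] K(2) by (auto simp: japanese_def)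
    qed
  qed
qed

section \<open>Weighted estimates\<close>

lemma japanese_measurable[measurable]: "japanese \<in> borel_measurable borel"
  unfolding japanese_def by measurable

lemma integrable_japanese_powr:
  assumes "q < - 1"
  shows "integrable lborel (\<lambda>x. japanese x powr q)"
proof -
  have "(\<lambda>x::real. x powr q) absolutely_integrable_on {1..}"
    using has_integral_powr_to_inf[of q 1] assms
    by (intro nonnegative_absolutely_integrable_1) (auto simp: integrable_on_def)
  then have tail: "integrable lborel (\<lambda>x. indicat_real {1..} x * x powr q)"
    by (simp add: set_integrable_def integrable_completion)
  have "integrable lborel (\<lambda>x. indicat_real {1..} (0 + (- 1) * x) * (0 + (- 1) * x) powr q)"
    by (rule lborel_integrable_real_affine[OF tail]) simp
  moreover have "integrable lborel (indicat_real {- 1..1::real})"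
    by (rule integrable_real_indicator) simp_all
  ultimately have "integrable lborel (\<lambda>x. indicat_real {- 1..1} x
      + (indicat_real {1..} x * x powr q + indicat_real {1..} (- x) * (- x) powr q))"
    using tail by simp
  then show ?thesis
  proof (rule Bochner_Integration.integrable_bound)
    have far: "japanese x powr q \<le> \<bar>x\<bar> powr q" if "1 \<le> \<bar>x\<bar>" for x
      using that assms japanese_ge(2)[of x] by (intro powr_mono2') auto
    have near: "japanese x powr q \<le> 1" for x
      using powr_mono2'[of q 1 "japanese x"] japanese_ge(1)[of x] assms by simp
    show "AE x in lborel. norm (japanese x powr q) \<le> norm (indicat_real {- 1..1} x
      + (indicat_real {1..} x * x powr q + indicat_real {1..} (- x) * (- x) powr q))"
    proof (rule AE_I2)
      fix x :: real
      consider "1 \<le> x" | "x \<le> - 1" | "\<bar>x\<bar> < 1" by linarith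
      then show "norm (japanese x powr q) \<le> norm (indicat_real {- 1..1} x
        + (indicat_real {1..} x * x powr q + indicat_real {1..} (- x) * (- x) powr q))"
        using far[of x] near[of x] by cases (auto simp: indicator_def)
    qed
  qed simp
qed

text \<open>Cauchy-Schwarz, from the nonnegativity of the integral of
  \<open>(s * a x - t * b x)\<^sup>2\<close> for all \<open>s\<close> and \<open>t\<close>.\<close>

lemma integral_mult_le_sqrt:
  fixes a b :: "'a \<Rightarrow> real"
  assumes [measurable]: "a \<in> borel_measurable M" "b \<in> borel_measurable M"
    and a2: "integrable M (\<lambda>x. (a x)\<^sup>2)" and b2: "integrable M (\<lambda>x. (b x)\<^sup>2)"
  shows "integrable M (\<lambda>x. a x * b x)"
    and "(LINT x|M. a x * b x) \<le> sqrt (LINT x|M. (a x)\<^sup>2) * sqrt (LINT x|M. (b x)\<^sup>2)"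
proof -
  show ab: "integrable M (\<lambda>x. a x * b x)"
  proof (rule Bochner_Integration.integrable_bound)
    show "integrable M (\<lambda>x. (a x)\<^sup>2 + (b x)\<^sup>2)" using a2 b2 by simp
    have "\<bar>a x * b x\<bar> \<le> (a x)\<^sup>2 + (b x)\<^sup>2" for x
      using sum_squares_bound[of "\<bar>a x\<bar>" "\<bar>b x\<bar>"] abs_ge_zero[of "a x * b x"]
      unfolding abs_mult power2_abs by linarith
    then show "AE x in M. norm (a x * b x) \<le> norm ((a x)\<^sup>2 + (b x)\<^sup>2)" by simp
  qed simp
  define P where "P = (LINT x|M. (a x)\<^sup>2)"
  define Q where "Q = (LINT x|M. a x * b x)"
  define R where "R = (LINT x|M. (b x)\<^sup>2)"
  have nonneg: "0 \<le> P" "0 \<le> R" by (simp_all add: P_def R_def)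
  have quad: "0 \<le> s\<^sup>2 * P - 2 * s * t * Q + t\<^sup>2 * R" for s t
  proof -
    have "0 \<le> (LINT x|M. (s * a x - t * b x)\<^sup>2)" by simp
    also have "(\<lambda>x. (s * a x - t * b x)\<^sup>2) = (\<lambda>x. s\<^sup>2 * (a x)\<^sup>2 - 2 * s * t * (a x * b x) + t\<^sup>2 * (b x)\<^sup>2)"
      by (auto simp: power2_eq_square algebra_simps)
    also have "integral\<^sup>L M \<dots> = s\<^sup>2 * P - 2 * s * t * Q + t\<^sup>2 * R"
      using a2 b2 ab by (simp add: P_def Q_def R_def)
    finally show ?thesis .
  qed
  have "Q\<^sup>2 \<le> P * R"
  proof (cases "R = 0")
    case True
    have "Q = 0"
    proof (rule ccontr)
      assume "Q \<noteq> 0"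
      \<comment> \<open>With \<open>R = 0\<close> the quadratic form is linear in \<open>t\<close>;
        this choice of \<open>t\<close> makes it \<open>-1\<close>.\<close>
      then show False using quad[of 1 "(P + 1) / (2 * Q)"] True by simp
    qed
    then show ?thesis using True by simp
  next
    case False
    then have "0 < R" using nonneg by simp
    moreover have "0 \<le> R * (P * R - Q\<^sup>2)"
      using quad[of R Q] by (simp add: power2_eq_square algebra_simps)
    ultimately show ?thesis by (simp add: zero_le_mult_iff)
  qed
  then have "Q \<le> sqrt (P * R)" by (rule real_le_rsqrt)
  then show "(LINT x|M. a x * b x) \<le> sqrt (LINT x|M. (a x)\<^sup>2) * sqrt (LINT x|M. (b x)\<^sup>2)"
    by (simp add: P_def Q_def R_def real_sqrt_mult)
qed

text \<open>Cauchy-Schwarz for the splitting \<open>3 = (3 - \<sigma>) + \<sigma>\<close>. Since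
  \<open>1 \<le> japanese y\<close>, the first claim also makes \<open>f\<close> itself integrable,
  as the exchange of integrals requires.\<close>

lemma japanese_moment_le:
  assumes "\<sigma> > 7 / 2" "L2 f" "L2 (weighted \<sigma> f)"
  shows "integrable lborel (\<lambda>y. japanese y ^ 3 * norm (f y))"
    and "(LINT y|lborel. japanese y ^ 3 * norm (f y))
      \<le> sqrt (LINT y|lborel. japanese y powr (6 - 2 * \<sigma>)) * L2_norm (weighted \<sigma> f)"
proof -
  have [measurable]: "f \<in> borel_measurable borel" using assms by (simp add: L2_def)
  have sq: "(japanese y powr (3 - \<sigma>))\<^sup>2 = japanese y powr (6 - 2 * \<sigma>)" for y
    by (simp add: power2_eq_square flip: powr_add)
  have prod: "japanese y powr (3 - \<sigma>) * norm (weighted \<sigma> f y) = japanese y ^ 3 * norm (f y)" for y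
  proof -
    have "japanese y powr (3 - \<sigma>) * japanese y powr \<sigma> = japanese y powr 3"
      by (simp flip: powr_add)
    also have "\<dots> = japanese y ^ 3"
      using japanese_ge(3)[of y] by simp
    finally show ?thesis by (simp add: weighted_def norm_mult mult.assoc[symmetric])
  qed
  have m: "(\<lambda>y. japanese y powr (3 - \<sigma>)) \<in> borel_measurable lborel"
    "(\<lambda>y. norm (weighted \<sigma> f y)) \<in> borel_measurable lborel"
    unfolding weighted_def by measurable
  have i: "integrable lborel (\<lambda>y. (japanese y powr (3 - \<sigma>))\<^sup>2)"
    unfolding sq using assms by (intro integrable_japanese_powr) simp
  have w: "integrable lborel (\<lambda>y. (norm (weighted \<sigma> f y))\<^sup>2)"
    using assms by (simp add: L2_def)
  show "integrable lborel (\<lambda>y. japanese y ^ 3 * norm (f y))"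
    using integral_mult_le_sqrt(1)[OF m i w] unfolding prod .
  show "(LINT y|lborel. japanese y ^ 3 * norm (f y))
      \<le> sqrt (LINT y|lborel. japanese y powr (6 - 2 * \<sigma>)) * L2_norm (weighted \<sigma> f)"
    using integral_mult_le_sqrt(2)[OF m i w] unfolding prod sq L2_norm_def .
qed

section \<open>From the kernel to the operator\<close>

lemma Psi_eq_dressed:
  assumes "0 < \<rho> 1" "\<rho> 1 < \<rho> 2"
  shows "Psi \<rho> \<theta> \<alpha> x l = dressed (parity_sign \<alpha>) (coeff0 \<rho> \<theta> x) (coeff1 \<rho> \<theta> x) x (of_real l)
    / of_real (sqrt (2 * pi * (l\<^sup>2 + (\<rho> 1)\<^sup>2) * (l\<^sup>2 + (\<rho> 2)\<^sup>2)))"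
proof -
  obtain b0 b1 where c: "dressing_coeffs \<rho> \<theta> x = (coeff0 \<rho> \<theta> x, coeff1 \<rho> \<theta> x, b0, b1)"
    using dressing_coeffs_eq[OF assms, of \<theta> x] by blast
  have "a_fun \<rho> \<theta> x z = (z\<^sup>2 + coeff1 \<rho> \<theta> x * z + coeff0 \<rho> \<theta> x) * exp (- 2 * \<i> * z * of_real x)" for z
    by (simp add: a_fun_def c)
  then show ?thesis
    by (cases \<alpha>) (simp_all add: Psi_def dressed_def parity_sign_def)
qed

text \<open>At real \<open>l\<close> conjugation affects only the coefficients and the sign of
  \<open>y\<close>, so the conjugated factor also becomes a function holomorphic in
  \<open>l\<close>.\<close>

lemma Psi_mult_cnj_Psi:
  assumes "0 < \<rho> 1" "\<rho> 1 < \<rho> 2"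
  shows "Psi \<rho> \<theta> \<alpha> x l * cnj (Psi \<rho> \<theta> \<alpha> y l) =
    spectral_kernel \<rho> \<alpha> (coeff0 \<rho> \<theta> x) (coeff1 \<rho> \<theta> x) x
      (cnj (coeff0 \<rho> \<theta> y)) (cnj (coeff1 \<rho> \<theta> y)) (- y) (of_real l)"
proof -
  let ?W = "2 * pi * (l\<^sup>2 + (\<rho> 1)\<^sup>2) * (l\<^sup>2 + (\<rho> 2)\<^sup>2)"
  have "complex_of_real (sqrt ?W) * complex_of_real (sqrt ?W) = complex_of_real ?W"
    by (simp flip: of_real_mult)
  also have "\<dots> = spectral_weight \<rho> (of_real l)"
    by (simp add: spectral_weight_def)
  finally have W: "complex_of_real (sqrt ?W) * complex_of_real (sqrt ?W) = spectral_weight \<rho> (of_real l)" .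
  show ?thesis
    unfolding Psi_eq_dressed[OF assms] spectral_kernel_def complex_cnj_divide cnj_dressed
      complex_cnj_complex_of_real cnj_parity_sign times_divide_times_eq W ..
qed

text \<open>Stated for composed arguments, so that joint measurability on product spaces is an
  instance.\<close>

lemma Psi_measurable:
  assumes "0 < \<rho> 1" "\<rho> 1 < \<rho> 2"
    and [measurable]: "g \<in> borel_measurable M" "h \<in> borel_measurable M"
  shows "(\<lambda>w. Psi \<rho> \<theta> \<alpha> (g w) (h w)) \<in> borel_measurable M"
proof -
  have [measurable]: "coeff0 \<rho> \<theta> \<in> borel_measurable borel" "coeff1 \<rho> \<theta> \<in> borel_measurable borel"
    by (intro borel_measurable_continuous_onI continuous_on_coeff[OF assms(1,2)])+
  have [measurable]: "(exp :: complex \<Rightarrow> complex) \<in> borel_measurable borel"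
    by (intro borel_measurable_continuous_onI continuous_intros)
  show ?thesis
    unfolding Psi_eq_dressed[OF assms(1,2)] dressed_def by measurable
qed

lemma resolvent_factor_measurable[measurable]:
  "resolvent_factor \<kappa> r \<mu> \<delta> \<in> borel_measurable borel"
proof -
  have [measurable]: "(exp :: complex \<Rightarrow> complex) \<in> borel_measurable borel"
    by (intro borel_measurable_continuous_onI continuous_intros)
  show ?thesis unfolding resolvent_factor_def by measurable
qed

text \<open>Not uniform in \<open>\<delta>\<close>: it provides absolute convergence at fixed
  \<open>\<delta>\<close>, for Fubini.\<close>

lemma norm_resolvent_factor_le:
  assumes "\<kappa> \<in> {1, -1}" "\<delta> > 0"
  shows "norm (resolvent_factor \<kappa> r \<mu> \<delta> l) \<le> (1 + (1 + \<bar>\<mu>\<bar>) / \<delta>) * (1 / ((l - 0)\<^sup>2 + 1\<^sup>2))"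
proof -
  define q where "q = 2 * complex_of_real (l\<^sup>2) - 2 * complex_of_real \<mu> - 2 * \<i> * complex_of_real \<kappa> * complex_of_real \<delta>"
  have Im: "\<delta> \<le> norm q"
    using abs_Im_le_cmod[of q] assms by (auto simp: q_def)
  have "1 + l\<^sup>2 \<le> norm q + (1 + \<bar>\<mu>\<bar>)"
    using abs_Re_le_cmod[of q] zero_le_power2[of l] by (auto simp: q_def)
  also have "1 + \<bar>\<mu>\<bar> \<le> (1 + \<bar>\<mu>\<bar>) / \<delta> * norm q"
    using mult_left_mono[OF Im, of "(1 + \<bar>\<mu>\<bar>) / \<delta>"] assms by simp
  finally have "1 + l\<^sup>2 \<le> (1 + (1 + \<bar>\<mu>\<bar>) / \<delta>) * norm q"
    by (simp add: algebra_simps)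
  moreover have "0 < norm q" "0 < 1 + l\<^sup>2" using Im assms by (auto intro: add_pos_nonneg)
  ultimately have "1 / norm q \<le> (1 + (1 + \<bar>\<mu>\<bar>) / \<delta>) * (1 / (1 + l\<^sup>2))"
    by (simp add: field_simps)
  moreover have "norm (resolvent_factor \<kappa> r \<mu> \<delta> l) = 1 / norm q"
    by (simp add: resolvent_factor_def q_def norm_divide)
  ultimately show ?thesis by (simp add: add.commute)
qed

lemma integrable_product_bound:
  fixes f :: "real \<times> real \<Rightarrow> complex" and u v :: "real \<Rightarrow> real"
  assumes "f \<in> borel_measurable (lborel \<Otimes>\<^sub>M lborel)" "integrable lborel u" "integrable lborel v"
    and "\<And>x y. norm (f (x, y)) \<le> u x * v y"
  shows "integrable (lborel \<Otimes>\<^sub>M lborel) f"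
proof (rule Bochner_Integration.integrable_bound[OF _ assms(1)])
  have [measurable]: "u \<in> borel_measurable borel" "v \<in> borel_measurable borel"
    using assms(2,3)[THEN borel_measurable_integrable] by simp_all
  show "integrable (lborel \<Otimes>\<^sub>M lborel) (\<lambda>p. u (fst p) * v (snd p))"
  proof (rule lborel_pair.Fubini_integrable)
    show "integrable lborel (\<lambda>x. LINT y|lborel. norm (u (fst (x, y)) * v (snd (x, y))))"
      using assms(2) by (simp add: abs_mult)
  qed (use assms(3) in auto)
  show "AE p in lborel \<Otimes>\<^sub>M lborel. norm (f p) \<le> norm (u (fst p) * v (snd p))"
  proof (rule AE_I2)
    fix p :: "real \<times> real"
    show "norm (f p) \<le> norm (u (fst p) * v (snd p))"
      using assms(4)[of "fst p" "snd p"] by simp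
  qed
qed

text \<open>At fixed \<open>\<delta>\<close> the double integral over \<open>l\<close> and
  \<open>y\<close> converges absolutely, so the inner product with \<open>f\<close> can be moved
  outside the spectral integral. The measurability claims feed dominated convergence in
  \<open>y\<close> and the measurability of the limit in \<open>x\<close>.\<close>

lemma resolvent_evolution_kernel:
  assumes \<rho>: "0 < \<rho> 1" "\<rho> 1 < \<rho> 2" and \<kappa>: "\<kappa> \<in> {1, -1}" and "\<delta> > 0" and f: "integrable lborel f"
  shows "resolvent_evolution_Pc \<rho> \<theta> \<beta> (2 * complex_of_real \<mu> + 2 * \<i> * complex_of_real \<kappa> * complex_of_real \<delta>)
      (\<kappa> * r) \<alpha> f x =
    (LINT y|lborel. f y * (LINT l:{0..}|lborel. resolvent_factor \<kappa> r \<mu> \<delta> l *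
      spectral_kernel \<rho> \<alpha> (coeff0 \<rho> \<theta> x) (coeff1 \<rho> \<theta> x) x
        (cnj (coeff0 \<rho> \<theta> y)) (cnj (coeff1 \<rho> \<theta> y)) (- y) (of_real l)))" (is "_ = ?rhs")
    and "(\<lambda>y. LINT l:{0..}|lborel. resolvent_factor \<kappa> r \<mu> \<delta> l *
      spectral_kernel \<rho> \<alpha> (coeff0 \<rho> \<theta> x) (coeff1 \<rho> \<theta> x) x
        (cnj (coeff0 \<rho> \<theta> y)) (cnj (coeff1 \<rho> \<theta> y)) (- y) (of_real l)) \<in> borel_measurable lborel"
    and "(\<lambda>x. resolvent_evolution_Pc \<rho> \<theta> \<beta> (2 * complex_of_real \<mu> + 2 * \<i> * complex_of_real \<kappa> * complex_of_real \<delta>)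
      (\<kappa> * r) \<alpha> f x) \<in> borel_measurable lborel"
proof -
  note [measurable (raw)] = Psi_measurable[OF \<rho>]
  have [measurable]: "cnj \<in> borel_measurable borel"
    by (intro borel_measurable_continuous_onI continuous_intros)
  have [measurable]: "f \<in> borel_measurable borel" using f by auto
  define m where "m = resolvent_factor \<kappa> r \<mu> \<delta>"
  have [measurable]: "m \<in> borel_measurable borel" by (simp add: m_def)
  define P where "P x l y = indicat_real {0..} l *\<^sub>R (m l * (cnj (Psi \<rho> \<theta> \<alpha> y l) * f y) * Psi \<rho> \<theta> \<alpha> x l)" for x l y
  have R: "resolvent_evolution_Pc \<rho> \<theta> \<beta> (2 * complex_of_real \<mu> + 2 * \<i> * complex_of_real \<kappa> * complex_of_real \<delta>)
      (\<kappa> * r) \<alpha> f x = (LINT l|lborel. LINT y|lborel. P x l y)" for x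
    unfolding resolvent_evolution_Pc_integral set_lebesgue_integral_def P_def L2_inner_def m_def
      resolvent_factor_def by simp
  have P: "P x l y = f y * (indicat_real {0..} l *\<^sub>R (m l * spectral_kernel \<rho> \<alpha> (coeff0 \<rho> \<theta> x) (coeff1 \<rho> \<theta> x) x
        (cnj (coeff0 \<rho> \<theta> y)) (cnj (coeff1 \<rho> \<theta> y)) (- y) (of_real l)))" for x l y
    unfolding Psi_mult_cnj_Psi[OF \<rho>, symmetric] P_def by simp
  obtain M where M: "M \<ge> 0" "\<And>x. norm (coeff0 \<rho> \<theta> x) \<le> M" "\<And>x. norm (coeff1 \<rho> \<theta> x) \<le> M"
    using norm_coeff_le[OF \<rho>, of \<theta>] by blast
  obtain A where A: "0 < A" "\<And>\<alpha> c0 c1 x d0 d1 y z.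
    norm c0 \<le> M \<Longrightarrow> norm c1 \<le> M \<Longrightarrow> norm d0 \<le> M \<Longrightarrow> norm d1 \<le> M \<Longrightarrow>
    \<bar>Im z\<bar> \<le> \<rho> 1 / 2 \<Longrightarrow> \<bar>Im z * x\<bar> \<le> 1 \<Longrightarrow> \<bar>Im z * y\<bar> \<le> 1 \<Longrightarrow>
    norm (spectral_kernel \<rho> \<alpha> c0 c1 x d0 d1 y z) \<le> A"
    using norm_spectral_kernel_le[OF \<rho>, of M] by blast
  define w where "w l = (1 + (1 + \<bar>\<mu>\<bar>) / \<delta>) * (1 / ((l - 0)\<^sup>2 + 1\<^sup>2))" for l :: real
  have "integrable (lborel \<Otimes>\<^sub>M lborel) (\<lambda>(l, y). P x l y)"
  proof (rule integrable_product_bound)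
    show "(\<lambda>(l, y). P x l y) \<in> borel_measurable (lborel \<Otimes>\<^sub>M lborel)"
      unfolding P_def by measurable
    show "integrable lborel w"
      unfolding w_def using has_bochner_integral_lorentzian[of 1 0]
      by (intro integrable_mult_right) (simp add: has_bochner_integral_iff)
    show "integrable lborel (\<lambda>y. A * norm (f y))" using f by simp
    fix l y
    have wl: "norm (m l) \<le> w l"
      unfolding m_def w_def by (rule norm_resolvent_factor_le[OF \<kappa> \<open>\<delta> > 0\<close>])
    have "norm (P x l y) \<le> norm (f y) * (w l * A)"
      unfolding P norm_mult norm_scaleR
      by (intro mult_left_mono) (use wl A M \<rho> in \<open>auto intro!: mult_mono simp: indicator_def order_trans[OF norm_ge_zero wl]\<close>)
    then show "norm (case (l, y) of (l, y) \<Rightarrow> P x l y) \<le> w l * (A * norm (f y))"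
      by (simp add: mult_ac)
  qed
  then have "(LINT l|lborel. LINT y|lborel. P x l y) = (LINT y|lborel. LINT l|lborel. P x l y)"
    by (rule lborel_pair.Fubini_integral[symmetric])
  also have "\<dots> = ?rhs"
    unfolding P set_lebesgue_integral_def m_def by (simp only: integral_mult_right_zero)
  finally show "resolvent_evolution_Pc \<rho> \<theta> \<beta> (2 * complex_of_real \<mu> + 2 * \<i> * complex_of_real \<kappa> * complex_of_real \<delta>)
      (\<kappa> * r) \<alpha> f x = ?rhs" unfolding R .
  show "(\<lambda>y. LINT l:{0..}|lborel. resolvent_factor \<kappa> r \<mu> \<delta> l *
      spectral_kernel \<rho> \<alpha> (coeff0 \<rho> \<theta> x) (coeff1 \<rho> \<theta> x) x
        (cnj (coeff0 \<rho> \<theta> y)) (cnj (coeff1 \<rho> \<theta> y)) (- y) (of_real l)) \<in> borel_measurable lborel"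
    unfolding Psi_mult_cnj_Psi[OF \<rho>, symmetric] set_lebesgue_integral_def by measurable
  show "(\<lambda>x. resolvent_evolution_Pc \<rho> \<theta> \<beta> (2 * complex_of_real \<mu> + 2 * \<i> * complex_of_real \<kappa> * complex_of_real \<delta>)
      (\<kappa> * r) \<alpha> f x) \<in> borel_measurable lborel"
    unfolding R P_def by measurable
qed

text \<open>The kernel bound is uniform in \<open>\<delta>\<close> and dominates the integrand in
  \<open>y\<close>, so the limit exists at every \<open>x\<close>. The pointwise bound by a multiple
  of \<open>japanese x ^ 3\<close> survives the limit and is square integrable after
  weighting.\<close>

proposition resolvent_evolution_decay:
  fixes \<rho> \<theta> :: "nat \<Rightarrow> real" and \<sigma> \<mu>min :: real
  assumes \<rho>: "0 < \<rho> 1" "\<rho> 1 < \<rho> 2" and \<sigma>: "\<sigma> > 7 / 2" and \<mu>min: "\<mu>min > 0"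
  obtains C where "C > 0" "\<And>\<mu> r \<kappa> f. \<bar>\<mu>\<bar> \<ge> \<mu>min \<Longrightarrow> r \<ge> 0 \<Longrightarrow> \<kappa> \<in> {1, -1} \<Longrightarrow> L2 f \<Longrightarrow> L2 (weighted \<sigma> f) \<Longrightarrow>
    \<exists>u. (\<forall>x. ((\<lambda>\<delta>. resolvent_evolution_Pc \<rho> \<theta> \<beta>
          (2 * complex_of_real \<mu> + 2 * \<i> * complex_of_real \<kappa> * complex_of_real \<delta>)
          (\<kappa> * r) \<alpha> f x) \<longlongrightarrow> u x) (at_right 0)) \<and>
      L2 (weighted (- \<sigma>) u) \<and>
      L2_norm (weighted (- \<sigma>) u)
        \<le> C * japanese r powr (- (1 / 2 + real (vanishing_order \<alpha>))) * L2_norm (weighted \<sigma> f)"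
proof -
  obtain M where M: "M \<ge> 0" "\<And>x. norm (coeff0 \<rho> \<theta> x) \<le> M" "\<And>x. norm (coeff1 \<rho> \<theta> x) \<le> M"
    using norm_coeff_le[OF \<rho>, of \<theta>] by blast
  obtain C where C: "0 < C" "\<And>\<alpha> c0 c1 d0 d1 x y \<mu> r \<kappa>.
    norm c0 \<le> M \<Longrightarrow> norm c1 \<le> M \<Longrightarrow> norm d0 \<le> M \<Longrightarrow> norm d1 \<le> M \<Longrightarrow>
    \<mu>min \<le> \<bar>\<mu>\<bar> \<Longrightarrow> 0 \<le> r \<Longrightarrow> \<kappa> \<in> {1, -1} \<Longrightarrow>
    \<exists>K. ((\<lambda>\<delta>. LINT l:{0..}|lborel. resolvent_factor \<kappa> r \<mu> \<delta> l
            * spectral_kernel \<rho> \<alpha> c0 c1 x d0 d1 y (of_real l)) \<longlongrightarrow> K) (at_right 0) \<and>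
      (\<forall>\<delta>>0. norm (LINT l:{0..}|lborel. resolvent_factor \<kappa> r \<mu> \<delta> l
            * spectral_kernel \<rho> \<alpha> c0 c1 x d0 d1 y (of_real l))
         \<le> C * (1 + r) powr (- (1 / 2 + real (vanishing_order \<alpha>))) * japanese x ^ 3 * japanese y ^ 3)"
    using kernel_limit_bound[OF \<rho> \<mu>min M(1)] by blast
  define J where "J = (LINT y|lborel. japanese y powr (6 - 2 * \<sigma>))"
  have J: "0 \<le> J" by (simp add: J_def)
  show thesis
  proof (rule that)
    \<comment> \<open>A factor \<open>sqrt J\<close> comes from the integral over \<open>y\<close>
      and another from the norm in \<open>x\<close>; adding \<open>1\<close> makes positivity
      immediate.\<close>
    show "0 < C * (J + 1)" using C J by (simp add: add_nonneg_pos)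
    fix \<mu> r \<kappa> :: real and f :: "real \<Rightarrow> complex"
    assume \<mu>: "\<mu>min \<le> \<bar>\<mu>\<bar>" and r: "0 \<le> r" and \<kappa>: "\<kappa> \<in> {1, -1}" and f: "L2 f" "L2 (weighted \<sigma> f)"
    define e where "e = - (1 / 2 + real (vanishing_order \<alpha>))"
    define N where "N = L2_norm (weighted \<sigma> f)"
    have N: "0 \<le> N" by (simp add: N_def L2_norm_def)
    have [measurable]: "f \<in> borel_measurable borel" using f by (simp add: L2_def)
    note moment = japanese_moment_le[OF \<sigma> f, folded J_def N_def]
    have f_int: "integrable lborel f"
    proof (rule Bochner_Integration.integrable_bound[OF moment(1)])
      have "norm (f y) \<le> japanese y ^ 3 * norm (f y)" for y
        using one_le_power[OF japanese_ge(1)[of y], of 3] mult_right_mono[of 1 "japanese y ^ 3" "norm (f y)"] by simp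
      then show "AE y in lborel. norm (f y) \<le> norm (japanese y ^ 3 * norm (f y))"
        using japanese_ge(3) by (simp add: abs_mult less_imp_le)
    qed simp
    define R where "R \<delta> x = resolvent_evolution_Pc \<rho> \<theta> \<beta>
      (2 * complex_of_real \<mu> + 2 * \<i> * complex_of_real \<kappa> * complex_of_real \<delta>) (\<kappa> * r) \<alpha> f x" for \<delta> x
    define k where "k \<delta> x y = (LINT l:{0..}|lborel. resolvent_factor \<kappa> r \<mu> \<delta> l *
      spectral_kernel \<rho> \<alpha> (coeff0 \<rho> \<theta> x) (coeff1 \<rho> \<theta> x) x
        (cnj (coeff0 \<rho> \<theta> y)) (cnj (coeff1 \<rho> \<theta> y)) (- y) (of_real l))" for \<delta> x y
    note kernel = resolvent_evolution_kernel(1,3)[where \<theta> = \<theta> and \<beta> = \<beta> and \<mu> = \<mu> and r = r and \<alpha> = \<alpha>,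
        OF \<rho> \<kappa> _ f_int, folded R_def k_def]
    note kernel_meas = resolvent_evolution_kernel(2)[where \<theta> = \<theta> and \<mu> = \<mu> and r = r and \<alpha> = \<alpha>,
        OF \<rho> \<kappa> _ f_int, folded k_def]
    \<comment> \<open>\<open>Lim\<close> selects the limit as a function of \<open>x\<close> and
      \<open>y\<close>; the kernel estimate only asserts its existence for each pair.\<close>
    define K where "K x y = Lim (at_right 0) (\<lambda>\<delta>. k \<delta> x y)" for x y
    have k_lim: "((\<lambda>\<delta>. k \<delta> x y) \<longlongrightarrow> K x y) (at_right 0)"
      and k_bound: "\<delta> > 0 \<Longrightarrow> norm (k \<delta> x y) \<le> C * (1 + r) powr e * japanese x ^ 3 * japanese y ^ 3" for x y \<delta>
    proof -
      obtain L where L: "((\<lambda>\<delta>. k \<delta> x y) \<longlongrightarrow> L) (at_right 0)"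
        "\<forall>\<delta>>0. norm (k \<delta> x y) \<le> C * (1 + r) powr e * japanese x ^ 3 * japanese (- y) ^ 3"
        using C(2)[of "coeff0 \<rho> \<theta> x" "coeff1 \<rho> \<theta> x" "cnj (coeff0 \<rho> \<theta> y)" "cnj (coeff1 \<rho> \<theta> y)" \<mu> r \<kappa> \<alpha> x "- y"]
          M \<mu> r \<kappa> unfolding k_def e_def by auto
      then show "((\<lambda>\<delta>. k \<delta> x y) \<longlongrightarrow> K x y) (at_right 0)"
        unfolding K_def by (metis tendsto_Lim trivial_limit_at_right_real)
      show "\<delta> > 0 \<Longrightarrow> norm (k \<delta> x y) \<le> C * (1 + r) powr e * japanese x ^ 3 * japanese y ^ 3"
        using L(2) by (simp add: japanese_def)
    qed
    define D where "D = C * (1 + r) powr e"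
    have D: "0 \<le> D" using C by (simp add: D_def)
    define w where "w x = (\<lambda>y. D * japanese x ^ 3 * (japanese y ^ 3 * norm (f y)))" for x
    have w_int: "integrable lborel (w x)" for x
      unfolding w_def by (intro integrable_mult_right moment)
    have fk: "norm (f y * k \<delta> x y) \<le> w x y" if "\<delta> > 0" for \<delta> x y
      using mult_left_mono[OF k_bound[OF that, of x y], of "norm (f y)"]
      by (simp add: norm_mult w_def D_def mult_ac)
    define u where "u x = (LINT y|lborel. f y * K x y)" for x
    have lim: "((\<lambda>\<delta>. R \<delta> x) \<longlongrightarrow> u x) (at_right 0)" for x
    proof -
      have "((\<lambda>\<delta>. LINT y|lborel. f y * k \<delta> x y) \<longlongrightarrow> u x) (at_right 0)"
        unfolding u_def
      proof (rule dominated_convergence_at_right[OF _ w_int[of x]])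
        fix \<delta> :: real assume "\<delta> > 0"
        note [measurable] = kernel_meas[OF this, of x]
        show "(\<lambda>y. f y * k \<delta> x y) \<in> borel_measurable lborel" by measurable
      qed (auto intro!: tendsto_intros k_lim fk)
      then show ?thesis
        by (rule Lim_transform_eventually)
           (auto intro!: eventually_mono[OF eventually_at_right_less] simp: kernel(1))
    qed
    have R_bound: "norm (R \<delta> x) \<le> D * japanese x ^ 3 * (sqrt J * N)" if "\<delta> > 0" for \<delta> x
    proof -
      have "norm (R \<delta> x) \<le> integral\<^sup>L lborel (w x)"
        unfolding kernel(1)[OF that] by (rule norm_integral_le[OF w_int fk[OF that]])
      also have "\<dots> = D * japanese x ^ 3 * (LINT y|lborel. japanese y ^ 3 * norm (f y))"
        unfolding w_def by (rule integral_mult_right_zero)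
      also have "\<dots> \<le> D * japanese x ^ 3 * (sqrt J * N)"
        using D japanese_ge(3)[of x] moment(2) by (intro mult_left_mono) auto
      finally show ?thesis .
    qed
    have u_bound: "norm (u x) \<le> D * japanese x ^ 3 * (sqrt J * N)" for x
      by (rule tendsto_upperbound[OF tendsto_norm[OF lim]])
         (auto intro!: eventually_mono[OF eventually_at_right_less] R_bound)
    have u_meas[measurable]: "u \<in> borel_measurable borel"
    proof -
      \<comment> \<open>Measurability passes to limits of sequences, so \<open>\<delta>\<close> is
        restricted to the values \<open>1 / (n + 1)\<close>.\<close>
      have "filterlim (\<lambda>n. inverse (real (Suc n))) (at_right 0) sequentially"
        using LIMSEQ_inverse_real_of_nat by (auto simp: filterlim_at)
      then have "(\<lambda>n. R (inverse (real (Suc n))) x) \<longlonglongrightarrow> u x" for x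
        by (rule filterlim_compose[OF lim])
      moreover have "R (inverse (real (Suc n))) \<in> borel_measurable borel" for n
        using kernel(2)[of "inverse (real (Suc n))"] by simp
      ultimately show ?thesis
        by (rule borel_measurable_LIMSEQ_metric[rotated])
    qed
    define B where "B = D * sqrt J * N"
    have B: "0 \<le> B" using D J N by (simp add: B_def)
    have wu: "(norm (weighted (- \<sigma>) u x))\<^sup>2 \<le> B\<^sup>2 * japanese x powr (6 - 2 * \<sigma>)" for x
    proof -
      have p: "japanese x powr (- \<sigma>) * japanese x ^ 3 = japanese x powr (3 - \<sigma>)"
      proof -
        have "japanese x ^ 3 = japanese x powr 3" using japanese_ge(3)[of x] by simp
        then show ?thesis by (simp flip: powr_add)
      qed
      have "norm (weighted (- \<sigma>) u x) = japanese x powr (- \<sigma>) * norm (u x)"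
        by (simp add: weighted_def norm_mult)
      also have "\<dots> \<le> japanese x powr (- \<sigma>) * (D * japanese x ^ 3 * (sqrt J * N))"
        by (intro mult_left_mono u_bound) simp
      also have "\<dots> = B * (japanese x powr (- \<sigma>) * japanese x ^ 3)"
        by (simp add: B_def mult_ac)
      finally have "norm (weighted (- \<sigma>) u x) \<le> B * japanese x powr (3 - \<sigma>)"
        unfolding p .
      then have "(norm (weighted (- \<sigma>) u x))\<^sup>2 \<le> (B * japanese x powr (3 - \<sigma>))\<^sup>2"
        by (intro power_mono) auto
      also have "\<dots> = B\<^sup>2 * japanese x powr (6 - 2 * \<sigma>)"
        by (simp add: power2_eq_square flip: powr_add)
      finally show ?thesis .
    qed
    have w_meas: "weighted (- \<sigma>) u \<in> borel_measurable lborel"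
      unfolding weighted_def by measurable
    have J_int: "integrable lborel (\<lambda>x. B\<^sup>2 * japanese x powr (6 - 2 * \<sigma>))"
      using \<sigma> by (intro integrable_mult_right integrable_japanese_powr) simp
    have L2u: "L2 (weighted (- \<sigma>) u)"
      unfolding L2_def using wu w_meas
      by (auto intro!: Bochner_Integration.integrable_bound[OF J_int] simp: measurable_compose)
    have "(LINT x|lborel. (norm (weighted (- \<sigma>) u x))\<^sup>2) \<le> B\<^sup>2 * J"
      using integral_mono[OF _ J_int wu] L2u by (simp add: L2_def J_def)
    then have "L2_norm (weighted (- \<sigma>) u) \<le> B * sqrt J"
      unfolding L2_norm_def using B by (intro real_le_lsqrt) (auto simp: power_mult_distrib J)
    also have "\<dots> = D * J * N"
      using J by (simp add: B_def)
    also have "\<dots> \<le> (C * japanese r powr e) * (J + 1) * N"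
    proof (intro mult_right_mono mult_mono)
      \<comment> \<open>The exponent \<open>e\<close> is negative, so
        \<open>japanese r \<le> 1 + r\<close> replaces \<open>1 + r\<close> by
        \<open>japanese r\<close> without a further constant.\<close>
      have "(japanese r)\<^sup>2 \<le> (1 + r)\<^sup>2"
        using r by (simp add: japanese_def power2_eq_square algebra_simps)
      then have "japanese r \<le> 1 + r" using r by - (rule power2_le_imp_le, auto)
      then have "(1 + r) powr e \<le> japanese r powr e"
        using japanese_ge(3)[of r] by (intro powr_mono2') (auto simp: e_def)
      then show "D \<le> C * japanese r powr e" using C by (simp add: D_def)
    qed (use C J N in auto)
    also have "\<dots> = C * (J + 1) * japanese r powr e * N" by simp
    finally have bound: "L2_norm (weighted (- \<sigma>) u) \<le> C * (J + 1) * japanese r powr e * N" .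
    show "\<exists>u. (\<forall>x. ((\<lambda>\<delta>. resolvent_evolution_Pc \<rho> \<theta> \<beta>
          (2 * complex_of_real \<mu> + 2 * \<i> * complex_of_real \<kappa> * complex_of_real \<delta>)
          (\<kappa> * r) \<alpha> f x) \<longlongrightarrow> u x) (at_right 0)) \<and>
      L2 (weighted (- \<sigma>) u) \<and>
      L2_norm (weighted (- \<sigma>) u)
        \<le> C * (J + 1) * japanese r powr (- (1 / 2 + real (vanishing_order \<alpha>))) * L2_norm (weighted \<sigma> f)"
      using lim L2u bound unfolding R_def e_def N_def by blast
  qed
qed

theorem propositionB2:
  fixes \<rho> \<theta> :: "nat \<Rightarrow> real" and \<beta> L \<sigma> \<mu>min :: real
  assumes "0 < \<rho> 1" and "\<rho> 1 < \<rho> 2"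
    and "L = pi / ((\<rho> 2)\<^sup>2 - (\<rho> 1)\<^sup>2)"
    and "0 < \<beta>"
    and "exp (2 * \<i> * complex_of_real (\<beta> * L)) = exp (2 * \<i> * complex_of_real ((\<rho> 1)\<^sup>2 * L))"
    and "exp (2 * \<i> * complex_of_real (\<beta> * L)) = exp (2 * \<i> * complex_of_real ((\<rho> 2)\<^sup>2 * L))"
    and "\<sigma> > 7 / 2" and "\<mu>min > 0"
  shows "\<exists>Me Mo :: real. Me > 0 \<and> Mo > 0 \<and>
    (\<forall>\<mu> r \<kappa> :: real. \<forall>f :: real \<Rightarrow> complex.
      \<bar>\<mu>\<bar> \<ge> \<mu>min \<longrightarrow> r \<ge> 0 \<longrightarrow> \<kappa> \<in> {1, -1} \<longrightarrow> L2 f \<longrightarrow> L2 (weighted \<sigma> f) \<longrightarrow>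
      (\<exists>u :: real \<Rightarrow> complex.
         (\<forall>x. ((\<lambda>\<delta>. resolvent_evolution_Pc \<rho> \<theta> \<beta>
                  (2 * complex_of_real \<mu> + 2 * \<i> * complex_of_real \<kappa> * complex_of_real \<delta>)
                  (\<kappa> * r) Ev f x) \<longlongrightarrow> u x) (at_right 0)) \<and>
         L2 (weighted (- \<sigma>) u) \<and>
         L2_norm (weighted (- \<sigma>) u)
           \<le> Me * japanese r powr (- 1 / 2) * L2_norm (weighted \<sigma> f)) \<and>
      (\<exists>u :: real \<Rightarrow> complex.
         (\<forall>x. ((\<lambda>\<delta>. resolvent_evolution_Pc \<rho> \<theta> \<beta>
                  (2 * complex_of_real \<mu> + 2 * \<i> * complex_of_real \<kappa> * complex_of_real \<delta>)
                  (\<kappa> * r) Od f x) \<longlongrightarrow> u x) (at_right 0)) \<and>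
         L2 (weighted (- \<sigma>) u) \<and>
         L2_norm (weighted (- \<sigma>) u)
           \<le> Mo * japanese r powr (- 3 / 2) * L2_norm (weighted \<sigma> f)))"
proof -
  \<comment> \<open>Both parities are instances of the same estimate; only the vanishing order at
    \<open>l = 0\<close> distinguishes the two rates.\<close>
  note decay = resolvent_evolution_decay[OF assms(1,2,7,8), where \<theta> = \<theta> and \<beta> = \<beta>]
  have e: "- (1 / 2 + real (vanishing_order Ev)) = - 1 / 2"
    "- (1 / 2 + real (vanishing_order Od)) = - 3 / 2"
    by (simp_all add: vanishing_order_def)
  show ?thesis
  proof (rule decay[where \<alpha> = Ev, unfolded e], rule decay[where \<alpha> = Od, unfolded e], goal_cases)
    case (1 Me Mo)
    show ?case
      by (rule exI[of _ Me], rule exI[of _ Mo], intro conjI allI impI 1)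
  qed
qed

end
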